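(* Let $n\ge 1$, let $\boldsymbol\theta=(\theta_1,\dots,\theta_n)$ be nonzero complex numbers, and let $F$ be one of the functions $F_{\alpha^+,q}(z)=(1-qz)^{-1}$, $F_{\alpha^-,q}(z)=(1-qz^{-1})^{-1}$ ($0\le q<1$), $F_{\beta^+,p}(z)=1+pz$, $F_{\beta^-,p}(z)=1+pz^{-1}$ ($0\le p\le 1$), $F_{\gamma^+,t}(z)=e^{tz}$, $F_{\gamma^-,t}(z)=e^{tz^{-1}}$ ($t\ge 0$). Assume that $F$ is analytic in an annulus $A$ centered at the origin which contains all $\theta_j^{-1}$, that $F(\theta_j^{-1})\neq 0$ for every $j$, and that $s_\nu(\boldsymbol\theta)\ne 0$ for every $\nu\in\mathcal W_n$. Then for all $\lambda,\tau\in\mathcal W_n$, $$\sum_{\mu\in\mathcal W_n}\mathbb P_n(\boldsymbol\theta;F)(\mu)\,c_{\lambda\mu}^{\tau}\,\frac{s_\tau(\boldsymbol\theta)}{s_\lambda(\boldsymbol\theta)s_\mu(\boldsymbol\theta)}=T_n(\boldsymbol\theta;F)(\lambda,\tau).$$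
   Context: $\mathcal W_n=\{\lambda=(\lambda_1\ge\dots\ge\lambda_n):\lambda_i\in\mathbb Z\}$. For $\lambda\in\mathcal W_n$, $s_\lambda(\theta_1,\dots,\theta_n)=\det[\theta_i^{\lambda_j+n-j}]_{i,j=1}^n/\det[\theta_i^{n-j}]_{i,j=1}^n$ is the Schur (Laurent) polynomial, extended to coinciding arguments as a Laurent polynomial. For $F$ analytic in the annulus $A$, put $f(m)=\frac1{2\pi i}\oint \frac{F(z)}{z^{m+1}}\,dz$ for $m\in\mathbb Z$, the integral being over a positively oriented simple loop in $A$ around the origin. Define the matrix $T_n(\boldsymbol\theta;F)$ with rows and columns indexed by $\mathcal W_n$ by $$T_n(\boldsymbol\theta;F)(\lambda,\mu)=\frac{s_\mu(\boldsymbol\theta)}{s_\lambda(\boldsymbol\theta)}\,\frac{\det[f(\lambda_i-i-\mu_j+j)]_{i,j=1}^n}{\prod_{j=1}^nF(\theta_j^{-1})},$$ and $\mathbb P_n(\boldsymbol\theta;F)(\mu)=T_n(\boldsymbol\theta;F)(\boldsymbol 0,\mu)$ where $\boldsymbol 0=(0,\dots,0)$. The Littlewood--Richardson coefficients $c_{\lambda\mu}^{\tau}$ ($\lambda,\mu,\tau\in\mathcal W_n$) are determined by $s_\lambda s_\mu=\sum_{\tau\in\mathcal W_n}c_{\lambda\mu}^\tau s_\tau$ in $n$ variables. When all entries are nonnegative, $c_{\lambda\mu}^\tau$ is the number of Littlewood--Richardson tableaux of shape $\tau\backslash\lambda$ and weight $\mu$ (semistandard skew tableaux of shape $\tau\backslash\lambda$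 in which $k$ appears $\mu_k$ times and such that every initial part of the sequence obtained by concatenating the reversed rows contains each $k$ at least as often as $k+1$). For negative entries the definition is extended by shifting, $c^{\tau-\mathbf 1}_{\lambda-\mathbf 1,\mu}=c^\tau_{\lambda\mu}$ and $c^\tau_{\lambda\mu}=c^\tau_{\mu\lambda}$, with $\mathbf 1=(1,\dots,1)$. For fixed $\lambda,\tau$ only finitely many $\mu$ have $c_{\lambda\mu}^\tau\ne0$. *)

theory Defs
  imports
    "HOL-Complex_Analysis.Complex_Analysis"
    "Jordan_Normal_Form.Determinant"
begin

text \<open>Throughout, indices run over 0, ..., n - 1 instead of 1, ..., n, and
  \<^term>\<open>Determinant.det\<close> is the determinant of \<open>n\<close> by \<open>n\<close> matrices for a variable \<open>n\<close>.\<close>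

definition weights :: "nat \<Rightarrow> int list set" where
  "weights n = {l. length l = n \<and> sorted_wrt (\<ge>) l}"

definition nonzero_args :: "nat \<Rightarrow> (nat \<Rightarrow> complex) set" where
  "nonzero_args n = {x. \<forall>i<n. x i \<noteq> 0}"

definition alternant :: "nat \<Rightarrow> int list \<Rightarrow> (nat \<Rightarrow> complex) \<Rightarrow> complex" where
  "alternant n l x =
     Determinant.det (Matrix.mat n n (\<lambda>(i, j). x i powi (l ! j + int n - 1 - int j)))"

definition laurent_polynomial :: "nat \<Rightarrow> ((nat \<Rightarrow> complex) \<Rightarrow> complex) \<Rightarrow> bool" where
  "laurent_polynomial n g \<longleftrightarrow>
     (\<exists>E a. finite E \<and> (\<forall>e\<in>E. length e = n) \<and>
        (\<forall>x\<in>nonzero_args n. g x = (\<Sum>e\<in>E. a e * (\<Prod>i<n. x i powi (e ! i :: int)))))"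

text \<open>The points with nonzero, pairwise distinct coordinates are dense among the points with
  nonzero coordinates, so the choice below is unique on the latter; its value at points with a
  zero coordinate is irrelevant. The denominator is the Vandermonde determinant.\<close>

definition schur :: "nat \<Rightarrow> int list \<Rightarrow> (nat \<Rightarrow> complex) \<Rightarrow> complex" where
  "schur n l = (SOME g. laurent_polynomial n g \<and>
     (\<forall>x\<in>nonzero_args n. inj_on x {..<n} \<longrightarrow>
        g x = alternant n l x / alternant n (replicate n 0) x))"

text \<open>The Schur Laurent polynomials are linearly independent over the complex numbers, so the
  expansion of the product is already unique among complex coefficient families.\<close>

definition LR_coeff :: "nat \<Rightarrow> int list \<Rightarrow> int list \<Rightarrow> int list \<Rightarrow> complex" where
  "LR_coeff n l m = (THE c. finite {t. c t \<noteq> 0} \<and> {t. c t \<noteq> 0} \<subseteq> weights n \<and>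
     (\<forall>x\<in>nonzero_args n. schur n l x * schur n m x = (\<Sum>t | c t \<noteq> 0. c t * schur n t x)))"

definition annulus :: "real \<Rightarrow> ereal \<Rightarrow> complex set" where
  "annulus r R = {z. r < norm z \<and> ereal (norm z) < R}"

definition simple_positive_loop :: "complex set \<Rightarrow> (real \<Rightarrow> complex) \<Rightarrow> bool" where
  "simple_positive_loop A \<gamma> \<longleftrightarrow> valid_path \<gamma> \<and> simple_path \<gamma> \<and> pathfinish \<gamma> = pathstart \<gamma> \<and>
     path_image \<gamma> \<subseteq> A \<and> 0 \<notin> path_image \<gamma> \<and> winding_number \<gamma> 0 = 1"

definition loop_coeff :: "(real \<Rightarrow> complex) \<Rightarrow> (complex \<Rightarrow> complex) \<Rightarrow> int \<Rightarrow> complex" where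
  "loop_coeff \<gamma> F m =
     1 / (2 * of_real pi * \<i>) * contour_integral \<gamma> (\<lambda>z. F z / z powi (m + 1))"

definition T_matrix ::
  "nat \<Rightarrow> (nat \<Rightarrow> complex) \<Rightarrow> (complex \<Rightarrow> complex) \<Rightarrow> (real \<Rightarrow> complex) \<Rightarrow>
   int list \<Rightarrow> int list \<Rightarrow> complex" where
  "T_matrix n \<theta> F \<gamma> l m =
     schur n m \<theta> / schur n l \<theta> *
     (Determinant.det (Matrix.mat n n
        (\<lambda>(i, j). loop_coeff \<gamma> F (l ! i - int i - m ! j + int j)))
      / (\<Prod>j<n. F (inverse (\<theta> j))))"

definition P_weight ::
  "nat \<Rightarrow> (nat \<Rightarrow> complex) \<Rightarrow> (complex \<Rightarrow> complex) \<Rightarrow> (real \<Rightarrow> complex) \<Rightarrow>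
   int list \<Rightarrow> complex" where
  "P_weight n \<theta> F \<gamma> m = T_matrix n \<theta> F \<gamma> (replicate n 0) m"

definition F_alpha_plus :: "real \<Rightarrow> complex \<Rightarrow> complex" where
  "F_alpha_plus q z = inverse (1 - of_real q * z)"

definition F_alpha_minus :: "real \<Rightarrow> complex \<Rightarrow> complex" where
  "F_alpha_minus q z = inverse (1 - of_real q * inverse z)"

definition F_beta_plus :: "real \<Rightarrow> complex \<Rightarrow> complex" where
  "F_beta_plus p z = 1 + of_real p * z"

definition F_beta_minus :: "real \<Rightarrow> complex \<Rightarrow> complex" where
  "F_beta_minus p z = 1 + of_real p * inverse z"

definition F_gamma_plus :: "real \<Rightarrow> complex \<Rightarrow> complex" where
  "F_gamma_plus t z = exp (of_real t * z)"

definition F_gamma_minus :: "real \<Rightarrow> complex \<Rightarrow> complex" where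
  "F_gamma_minus t z = exp (of_real t * inverse z)"

definition elementary_functions :: "(complex \<Rightarrow> complex) set" where
  "elementary_functions =
     {F. (\<exists>q. 0 \<le> q \<and> q < 1 \<and> (F = F_alpha_plus q \<or> F = F_alpha_minus q)) \<or>
         (\<exists>p. 0 \<le> p \<and> p \<le> 1 \<and> (F = F_beta_plus p \<or> F = F_beta_minus p)) \<or>
         (\<exists>t. 0 \<le> t \<and> (F = F_gamma_plus t \<or> F = F_gamma_minus t))}"

end

theory Submission
  imports Defs
begin

text \<open>The common factor \<open>s\<^sub>t / s\<^sub>l\<close>, divided by the product of the \<open>F (inverse (\<theta> j))\<close>, appears on both
  sides. Since \<open>s\<^sub>0 = 1\<close>, what remains is an identity between Toeplitz minors and
  Littlewood-Richardson coefficients: if \<open>D l m\<close> is the determinant of the matrix with entries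
  \<open>f (l ! i - i - m ! j + j)\<close>, then \<open>D l t\<close> is the sum over \<open>m\<close> of \<open>D 0 m\<close> times the
  Littlewood-Richardson coefficient of \<open>l\<close>, \<open>m\<close> and \<open>t\<close>. The reason is that \<open>D l m\<close> is formally the
  coefficient of \<open>s\<^sub>m\<close> in \<open>s\<^sub>l\<close> times the product of the \<open>F (inverse (x j))\<close>: expanding this product for
  \<open>l = 0\<close> and then multiplying by \<open>s\<^sub>l\<close> must give the same as expanding for \<open>l\<close> directly.

  The proof below is a finite form of this argument, in which no series has to be summed.
  Write \<open>\<delta> = (n - 1, ..., 0)\<close>, \<open>a\<^sub>l\<close> for the alternant of \<open>l\<close>, whose exponents are the
  rearrangements of \<open>l + \<delta>\<close>, and \<open>K e\<close> for the coefficient of \<open>x ^ e\<close> in \<open>s\<^sub>l\<close>. As \<open>s\<^sub>l\<close> is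
  symmetric, the product of \<open>s\<^sub>l\<close> and \<open>a\<^sub>m\<close> is alternating, hence a combination of alternants, and reading off the
  coefficient of the decreasing exponent \<open>t + \<delta>\<close> gives the Littlewood-Richardson coefficient as the
  alternating sum of \<open>K (t + \<delta> - p (m + \<delta>))\<close> over all permutations \<open>p\<close> (lemma \<open>LR_coeff_eq\<close>).
  Substituting this, the sum over \<open>m\<close> and \<open>p\<close> runs over all vectors of distinct integers and
  becomes the sum over \<open>e\<close> of \<open>K e\<close> times the determinant of \<open>f (\<delta> ! i + e ! j - (t + \<delta>) ! j)\<close>. This is the image of
  the product of \<open>s\<^sub>l\<close> and \<open>a\<^sub>0\<close> under the linear map that sends \<open>x ^ g\<close> to the product of the
  \<open>f (g ! j - (t + \<delta>) ! j)\<close>. That product of functions is \<open>a\<^sub>l\<close>, whose image is \<open>D l t\<close> (lemmas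
  \<open>schur_coeff_convolution\<close> and \<open>toeplitz_minor_LR_sum\<close>).

  Two facts support this. Laurent monomials are linearly independent as functions on the points
  with distinct nonzero coordinates (\<open>laurent_monomials_independent\<close>), so identities between functions are
  identities between coefficients, and the expansion that defines the Littlewood-Richardson
  coefficients is unique. And the quotient of \<open>a\<^sub>l\<close> by \<open>a\<^sub>0\<close> is a Laurent polynomial
  (\<open>alternant_factorization\<close>), by Newton interpolation of powers at the points \<open>x i\<close>.\<close>

section \<open>Linear independence of Laurent monomials\<close>

definition laurent_monomial :: "nat \<Rightarrow> int list \<Rightarrow> (nat \<Rightarrow> complex) \<Rightarrow> complex" where
  "laurent_monomial n e x = (\<Prod>i<n. x i powi (e ! i))"

lemma laurent_monomial_add:
  assumes "length e = n" "length e' = n" "x \<in> nonzero_args n"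
  shows "laurent_monomial n (map2 (+) e e') x = laurent_monomial n e x * laurent_monomial n e' x"
  unfolding laurent_monomial_def prod.distrib[symmetric]
  using assms by (intro prod.cong) (auto simp: nonzero_args_def power_int_add)

lemma prod_power_int:
  fixes z :: "'a :: field"
  assumes "z \<noteq> 0" "finite A"
  shows "(\<Prod>i\<in>A. z powi f i) = z powi (\<Sum>i\<in>A. f i)"
  using assms(2) by induction (use assms(1) in \<open>auto simp: power_int_add\<close>)

text \<open>Two different exponent vectors \<open>e\<close> and \<open>e'\<close> receive the same weight only if \<open>N\<close> is
  a root of the nonzero polynomial with coefficients \<open>e ! i - e' ! i\<close>. Finitely many pairs of
  vectors exclude only finitely many values of \<open>N\<close>.\<close>

lemma exists_injective_weighting:
  assumes fin: "finite E" and len: "\<And>e. e \<in> E \<Longrightarrow> length e = n"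
  shows "\<exists>N\<ge>2. inj_on (\<lambda>e. \<Sum>i<n. e ! i * int N ^ i) E"
proof -
  define q :: "int list \<Rightarrow> int list \<Rightarrow> int poly"
    where "q e e' = (\<Sum>i<n. Polynomial.monom (e ! i - e' ! i) i)" for e e'
  have eval: "poly (q e e') z = (\<Sum>i<n. e ! i * z ^ i) - (\<Sum>i<n. e' ! i * z ^ i)" for e e' z
    unfolding q_def by (simp add: poly_sum poly_monom sum_subtractf algebra_simps)
  have nz: "q e e' \<noteq> 0" if e: "e \<in> E" "e' \<in> E" "e \<noteq> e'" for e e'
  proof -
    obtain i where "i < n" "e ! i \<noteq> e' ! i"
      using e len by (metis nth_equalityI)
    then have "coeff (q e e') i \<noteq> 0"
      by (simp add: q_def coeff_sum)
    then show ?thesis by auto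
  qed
  define bad where "bad = (\<Union>(e, e')\<in>{(e, e'). e \<in> E \<and> e' \<in> E \<and> e \<noteq> e'}. {z. poly (q e e') z = 0})"
  have "finite {(e, e'). e \<in> E \<and> e' \<in> E \<and> e \<noteq> e'}"
    by (rule finite_subset[OF _ finite_cartesian_product[OF fin fin]]) auto
  then have "finite bad"
    unfolding bad_def using nz by (auto intro!: finite_UN_I poly_roots_finite)
  then have "finite (int -` bad \<union> {..<2})"
    by (auto intro!: finite_vimageI)
  then obtain N where N: "N \<notin> int -` bad \<union> {..<2}"
    by (meson ex_new_if_finite infinite_UNIV_nat)
  have "inj_on (\<lambda>e. \<Sum>i<n. e ! i * int N ^ i) E"
  proof (intro inj_onI, rule ccontr)
    fix e e' assume *: "e \<in> E" "e' \<in> E" "(\<Sum>i<n. e ! i * int N ^ i) = (\<Sum>i<n. e' ! i * int N ^ i)" "e \<noteq> e'"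
    then have "poly (q e e') (int N) = 0" by (simp add: eval)
    with * have "int N \<in> bad" unfolding bad_def by blast
    with N show False by simp
  qed
  with N show ?thesis by (intro exI[of _ N]) auto
qed

text \<open>Kronecker substitution: at \<open>x i = k ^ (N ^ i)\<close> the monomial with exponent \<open>e\<close> becomes
  the power of \<open>k\<close> whose exponent is the weight of \<open>e\<close>. If \<open>N\<close> separates the exponents, the sum
  turns into a one-variable Laurent polynomial with the same coefficients and infinitely many
  roots \<open>k = 2, 3, ...\<close>. For \<open>N, k \<ge> 2\<close> the coordinates of this point are pairwise distinct, so
  that vanishing at such points is enough.\<close>

lemma laurent_monomials_independent:
  assumes fin: "finite E" and len: "\<And>e. e \<in> E \<Longrightarrow> length e = n"
    and zero: "\<And>x. x \<in> nonzero_args n \<Longrightarrow> inj_on x {..<n} \<Longrightarrow>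
      (\<Sum>e\<in>E. a e * laurent_monomial n e x) = 0"
    and d: "d \<in> E"
  shows "a d = 0"
proof -
  obtain N :: nat where N: "N \<ge> 2" "inj_on (\<lambda>e. \<Sum>i<n. e ! i * int N ^ i) E"
    using exists_injective_weighting[OF fin len] by blast
  define \<kappa> where "\<kappa> e = (\<Sum>i<n. e ! i * int N ^ i)" for e
  have inj: "inj_on \<kappa> E" using N(2) unfolding \<kappa>_def .
  \<comment> \<open>multiplication by the \<open>M\<close>-th power makes all exponents nonnegative\<close>
  define M where "M = (\<Sum>e\<in>E. \<bar>\<kappa> e\<bar>)"
  have M: "\<kappa> e + M \<ge> 0" if "e \<in> E" for e
    using member_le_sum[OF that, of "\<lambda>e. \<bar>\<kappa> e\<bar>"] fin unfolding M_def by auto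
  define p where "p = (\<Sum>e\<in>E. Polynomial.monom (a e) (nat (\<kappa> e + M)))"
  have root: "poly p (of_nat k) = 0" if k: "k \<ge> 2" for k
  proof -
    define x :: "nat \<Rightarrow> complex" where "x i = of_nat (k ^ (N ^ i))" for i
    have "inj_on x {..<n}"
      using k N(1) by (auto simp: x_def inj_on_def power_inject_exp simp flip: of_nat_power)
    moreover have "x \<in> nonzero_args n"
      using k by (auto simp: x_def nonzero_args_def)
    ultimately have "(\<Sum>e\<in>E. a e * laurent_monomial n e x) = 0"
      by (rule zero[rotated])
    moreover have "laurent_monomial n e x = of_nat k powi \<kappa> e" for e
    proof -
      have "laurent_monomial n e x = (\<Prod>i<n. of_nat k powi (e ! i * int N ^ i))"
        unfolding laurent_monomial_def
      proof (intro prod.cong refl)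
        fix i
        have "x i = of_nat k powi (int N ^ i)"
          using power_int_of_nat[of "of_nat k :: complex" "N ^ i"] by (simp add: x_def)
        then show "x i powi (e ! i) = of_nat k powi (e ! i * int N ^ i)"
          by (simp add: mult.commute flip: power_int_mult)
      qed
      also have "\<dots> = of_nat k powi \<kappa> e"
        unfolding \<kappa>_def by (rule prod_power_int) (use k in auto)
      finally show ?thesis .
    qed
    ultimately have "(\<Sum>e\<in>E. a e * of_nat k powi \<kappa> e) = 0" by simp
    then have "(\<Sum>e\<in>E. a e * of_nat k powi \<kappa> e) * of_nat k powi M = 0" by simp
    also have "(\<Sum>e\<in>E. a e * of_nat k powi \<kappa> e) * of_nat k powi M = poly p (of_nat k)"
      unfolding p_def poly_sum poly_monom sum_distrib_right
    proof (intro sum.cong refl)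
      fix e assume "e \<in> E"
      then have "\<kappa> e + M = int (nat (\<kappa> e + M))" using M by simp
      then have "of_nat k ^ nat (\<kappa> e + M) = (of_nat k :: complex) powi (\<kappa> e + M)"
        by (metis power_int_of_nat)
      also have "\<dots> = of_nat k powi \<kappa> e * of_nat k powi M"
        using k by (intro power_int_add) auto
      finally show "a e * of_nat k powi \<kappa> e * of_nat k powi M = a e * of_nat k ^ nat (\<kappa> e + M)"
        by simp
    qed
    finally show ?thesis .
  qed
  have "p = 0"
  proof (rule ccontr)
    assume "p \<noteq> 0"
    then have "finite {z. poly p z = 0}" by (rule poly_roots_finite)
    moreover have "of_nat ` {2..} \<subseteq> {z. poly p z = 0}" using root by auto
    ultimately have "finite ((of_nat :: nat \<Rightarrow> complex) ` {2..})" using finite_subset by blast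
    then have "finite {2 :: nat..}"
      by (rule finite_imageD) (simp add: inj_on_def)
    then show False by (simp add: infinite_Ici)
  qed
  then have "0 = coeff p (nat (\<kappa> d + M))" by simp
  also have "\<dots> = (\<Sum>e\<in>E. if e = d then a e else 0)"
    unfolding p_def coeff_sum coeff_monom
  proof (intro sum.cong refl)
    fix e assume "e \<in> E"
    then show "(if nat (\<kappa> e + M) = nat (\<kappa> d + M) then a e else 0) = (if e = d then a e else 0)"
      using M[of e] M[OF d] d inj by (auto simp: inj_on_def)
  qed
  also have "\<dots> = a d" using fin d by simp
  finally show ?thesis by simp
qed

text \<open>Because the monomials are independent, a linear map on Laurent polynomials may be prescribed
  freely by its values \<open>\<phi> e\<close> on the monomials. This is stated for an arbitrary indexed family,
  in which exponents may repeat.\<close>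

lemma laurent_functional_zero:
  assumes fin: "finite I" and len: "\<And>i. i \<in> I \<Longrightarrow> length (e i) = n"
    and zero: "\<And>x. x \<in> nonzero_args n \<Longrightarrow> inj_on x {..<n} \<Longrightarrow>
      (\<Sum>i\<in>I. c i * laurent_monomial n (e i) x) = 0"
  shows "(\<Sum>i\<in>I. c i * \<phi> (e i)) = (0::complex)"
proof -
  have group: "(\<Sum>i\<in>I. c i * \<psi> (e i)) = (\<Sum>g\<in>e ` I. (\<Sum>i | i \<in> I \<and> e i = g. c i) * \<psi> g)"
    for \<psi> :: "int list \<Rightarrow> complex"
    unfolding sum.image_gen[OF fin, of "\<lambda>i. c i * \<psi> (e i)" e] sum_distrib_right
    by (intro sum.cong) auto
  have "(\<Sum>i | i \<in> I \<and> e i = g. c i) = 0" if "g \<in> e ` I" for g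
  proof (rule laurent_monomials_independent[where E = "e ` I" and n = n])
    fix x assume "x \<in> nonzero_args n" "inj_on x {..<n}"
    then show "(\<Sum>g\<in>e ` I. (\<Sum>i | i \<in> I \<and> e i = g. c i) * laurent_monomial n g x) = 0"
      using group[of "\<lambda>g. laurent_monomial n g x"] zero by simp
  qed (use that fin len in auto)
  then show ?thesis unfolding group by simp
qed

text \<open>All later comparisons of coefficients are instances of this lemma or the previous one: with \<open>\<phi>\<close> an indicator it
  extracts one coefficient, with \<open>\<phi>\<close> an evaluation it carries an identity from points with
  distinct coordinates to all points, and with \<open>\<phi>\<close> a product of values of a sequence it turns
  alternants into Toeplitz minors.\<close>

lemma laurent_functional_eq:
  assumes fin: "finite I" "finite J"
    and len: "\<And>i. i \<in> I \<Longrightarrow> length (e i) = n" "\<And>j. j \<in> J \<Longrightarrow> length (e' j) = n"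
    and eq: "\<And>x. x \<in> nonzero_args n \<Longrightarrow> inj_on x {..<n} \<Longrightarrow>
      (\<Sum>i\<in>I. c i * laurent_monomial n (e i) x) = (\<Sum>j\<in>J. d j * laurent_monomial n (e' j) x)"
  shows "(\<Sum>i\<in>I. c i * \<phi> (e i)) = (\<Sum>j\<in>J. d j * (\<phi> (e' j) :: complex))"
proof -
  have split: "(\<Sum>k\<in>I <+> J. case_sum c (\<lambda>j. - d j) k * \<psi> (case_sum e e' k)) =
      (\<Sum>i\<in>I. c i * \<psi> (e i)) - (\<Sum>j\<in>J. d j * \<psi> (e' j))" for \<psi> :: "int list \<Rightarrow> complex"
    using fin by (simp add: sum.Plus sum_negf)
  have "(\<Sum>k\<in>I <+> J. case_sum c (\<lambda>j. - d j) k * \<phi> (case_sum e e' k)) = 0"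
  proof (rule laurent_functional_zero[where n = n])
    fix x assume "x \<in> nonzero_args n" "inj_on x {..<n}"
    then show "(\<Sum>k\<in>I <+> J. case_sum c (\<lambda>j. - d j) k * laurent_monomial n (case_sum e e' k) x) = 0"
      using split[of "\<lambda>g. laurent_monomial n g x"] eq by simp
  qed (use fin len in auto)
  then show ?thesis unfolding split by simp
qed

section \<open>Schur functions as Laurent polynomials\<close>

text \<open>Repeated exponents are merged by summing over the fibres of \<open>e\<close>, so that
  sums and products of Laurent polynomials can be presented by their evident index sets.\<close>

lemma laurent_polynomialI:
  assumes fin: "finite I" and len: "\<And>i. i \<in> I \<Longrightarrow> length (e i) = n"
    and g: "\<And>x. x \<in> nonzero_args n \<Longrightarrow> g x = (\<Sum>i\<in>I. c i * laurent_monomial n (e i) x)"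
  shows "laurent_polynomial n g"
  unfolding laurent_polynomial_def
proof (intro exI conjI ballI)
  show "finite (e ` I)" using fin by simp
  show "length k = n" if "k \<in> e ` I" for k using that len by auto
  show "g x = (\<Sum>k\<in>e ` I. (\<Sum>i | i \<in> I \<and> e i = k. c i) * (\<Prod>i<n. x i powi (k ! i)))"
    if "x \<in> nonzero_args n" for x
    unfolding g[OF that] laurent_monomial_def sum_distrib_right
      sum.image_gen[OF fin, of "\<lambda>i. c i * (\<Prod>j<n. x j powi (e i ! j))" e]
    by (intro sum.cong) auto
qed

lemma laurent_polynomialE:
  assumes "laurent_polynomial n g"
  obtains E a where "finite E" "\<And>e. e \<in> E \<Longrightarrow> length e = n"
    "\<And>x. x \<in> nonzero_args n \<Longrightarrow> g x = (\<Sum>e\<in>E. a e * laurent_monomial n e x)"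
  using assms unfolding laurent_polynomial_def laurent_monomial_def by blast

lemma laurent_polynomial_const: "laurent_polynomial n (\<lambda>_. c)"
  by (rule laurent_polynomialI[of "{()}" "\<lambda>_. replicate n 0" _ _ "\<lambda>_. c"])
     (auto simp: laurent_monomial_def)

lemma laurent_polynomial_coord:
  assumes "i < n"
  shows "laurent_polynomial n (\<lambda>x. x i powi k)"
proof (rule laurent_polynomialI[of "{()}" "\<lambda>_. (replicate n 0)[i := k]" _ _ "\<lambda>_. 1"])
  fix x :: "nat \<Rightarrow> complex"
  have "laurent_monomial n ((replicate n 0)[i := k]) x = (\<Prod>j<n. if j = i then x i powi k else 1)"
    unfolding laurent_monomial_def by (intro prod.cong) (auto simp: nth_list_update)
  then show "x i powi k = (\<Sum>_\<in>{()}. 1 * laurent_monomial n ((replicate n 0)[i := k]) x)"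
    using assms by simp
qed auto

lemma laurent_polynomial_add:
  assumes "laurent_polynomial n f" "laurent_polynomial n g"
  shows "laurent_polynomial n (\<lambda>x. f x + g x)"
proof -
  obtain E a where E: "finite E" "\<And>e. e \<in> E \<Longrightarrow> length e = n"
    "\<And>x. x \<in> nonzero_args n \<Longrightarrow> f x = (\<Sum>e\<in>E. a e * laurent_monomial n e x)"
    using laurent_polynomialE[OF assms(1)] by metis
  obtain E' b where E': "finite E'" "\<And>e. e \<in> E' \<Longrightarrow> length e = n"
    "\<And>x. x \<in> nonzero_args n \<Longrightarrow> g x = (\<Sum>e\<in>E'. b e * laurent_monomial n e x)"
    using laurent_polynomialE[OF assms(2)] by metis
  show ?thesis
    by (rule laurent_polynomialI[of "E <+> E'" "case_sum id id" _ _ "case_sum a b"])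
       (use E E' in \<open>auto simp: sum.Plus\<close>)
qed

lemma laurent_polynomial_mult:
  assumes "laurent_polynomial n f" "laurent_polynomial n g"
  shows "laurent_polynomial n (\<lambda>x. f x * g x)"
proof -
  obtain E a where E: "finite E" "\<And>e. e \<in> E \<Longrightarrow> length e = n"
    "\<And>x. x \<in> nonzero_args n \<Longrightarrow> f x = (\<Sum>e\<in>E. a e * laurent_monomial n e x)"
    using laurent_polynomialE[OF assms(1)] by metis
  obtain E' b where E': "finite E'" "\<And>e. e \<in> E' \<Longrightarrow> length e = n"
    "\<And>x. x \<in> nonzero_args n \<Longrightarrow> g x = (\<Sum>e\<in>E'. b e * laurent_monomial n e x)"
    using laurent_polynomialE[OF assms(2)] by metis
  show ?thesis
  proof (rule laurent_polynomialI[of "E \<times> E'" "\<lambda>(e, e'). map2 (+) e e'" _ _ "\<lambda>(e, e'). a e * b e'"])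
    fix x assume x: "x \<in> nonzero_args n"
    show "f x * g x = (\<Sum>i\<in>E \<times> E'. (case i of (e, e') \<Rightarrow> a e * b e') *
            laurent_monomial n (case i of (e, e') \<Rightarrow> map2 (+) e e') x)"
      unfolding E(3)[OF x] E'(3)[OF x] sum_product sum.cartesian_product
      using E(2) E'(2) x by (intro sum.cong) (auto simp: laurent_monomial_add)
  qed (use E E' in auto)
qed

lemma laurent_polynomial_sum:
  assumes "\<And>i. i \<in> I \<Longrightarrow> laurent_polynomial n (f i)"
  shows "laurent_polynomial n (\<lambda>x. \<Sum>i\<in>I. f i x)"
  using assms by (induction I rule: infinite_finite_induct)
    (auto intro: laurent_polynomial_const laurent_polynomial_add)

lemma laurent_polynomial_prod:
  assumes "\<And>i. i \<in> I \<Longrightarrow> laurent_polynomial n (f i)"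
  shows "laurent_polynomial n (\<lambda>x. \<Prod>i\<in>I. f i x)"
  using assms by (induction I rule: infinite_finite_induct)
    (auto intro: laurent_polynomial_const laurent_polynomial_mult)

lemma laurent_polynomial_det:
  assumes "\<And>i j. i < n \<Longrightarrow> j < n \<Longrightarrow> laurent_polynomial n (\<lambda>x. f x i j)"
  shows "laurent_polynomial n (\<lambda>x. Determinant.det (Matrix.mat n n (\<lambda>(i, j). f x i j)))"
proof -
  have "Determinant.det (Matrix.mat n n (\<lambda>(i, j). f x i j)) =
      (\<Sum>p | p permutes {0..<n}. of_int (sign p) * (\<Prod>i = 0..<n. f x i (p i)))" for x
    by (auto simp: Determinant.det_def permutes_in_image intro!: sum.cong prod.cong)
  moreover have "laurent_polynomial n
      (\<lambda>x. \<Sum>p | p permutes {0..<n}. of_int (sign p) * (\<Prod>i = 0..<n. f x i (p i)))"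
    using assms
    by (auto intro!: laurent_polynomial_sum laurent_polynomial_prod laurent_polynomial_mult
        laurent_polynomial_const simp: permutes_in_image)
  ultimately show ?thesis by simp
qed

lemma laurent_polynomial_eqI:
  assumes "laurent_polynomial n f" "laurent_polynomial n g"
    and eq: "\<And>x. x \<in> nonzero_args n \<Longrightarrow> inj_on x {..<n} \<Longrightarrow> f x = g x"
    and x: "x \<in> nonzero_args n"
  shows "f x = g x"
proof -
  obtain E a where E: "finite E" "\<And>e. e \<in> E \<Longrightarrow> length e = n"
    "\<And>x. x \<in> nonzero_args n \<Longrightarrow> f x = (\<Sum>e\<in>E. a e * laurent_monomial n e x)"
    using laurent_polynomialE[OF assms(1)] by metis
  obtain E' b where E': "finite E'" "\<And>e. e \<in> E' \<Longrightarrow> length e = n"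
    "\<And>x. x \<in> nonzero_args n \<Longrightarrow> g x = (\<Sum>e\<in>E'. b e * laurent_monomial n e x)"
    using laurent_polynomialE[OF assms(2)] by metis
  show ?thesis
    unfolding E(3)[OF x] E'(3)[OF x]
    by (rule laurent_functional_eq[where n = n and e = "\<lambda>e. e" and e' = "\<lambda>e. e"])
       (use E E' eq in \<open>simp_all flip: E(3) E'(3)\<close>)
qed

text \<open>The complete homogeneous symmetric polynomials, by the recursion on whether the first variable
  occurs. Here they appear as divided differences of powers.\<close>

fun complete_symmetric :: "nat \<Rightarrow> 'a :: comm_ring_1 list \<Rightarrow> 'a" where
  "complete_symmetric 0 ys = 1"
| "complete_symmetric (Suc k) [] = 0"
| "complete_symmetric (Suc k) (y # ys) =
     complete_symmetric (Suc k) ys + y * complete_symmetric k (y # ys)"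

definition complete_symmetric_int :: "int \<Rightarrow> 'a :: comm_ring_1 list \<Rightarrow> 'a" where
  "complete_symmetric_int k ys = (if k < 0 then 0 else complete_symmetric (nat k) ys)"

lemma complete_symmetric_single: "complete_symmetric k [y] = y ^ k"
  by (induction k) auto

text \<open>This is the recursion of divided differences: over the nodes \<open>x, y, ys\<close>
  the divided difference of a power is again a complete symmetric polynomial, of degree one less
  for each new node.\<close>

lemma complete_symmetric_difference:
  "complete_symmetric (Suc k) (x # ys) - complete_symmetric (Suc k) (y # ys) =
     (x - y) * complete_symmetric k (x # y # ys)"
proof (induction k)
  case (Suc k)
  note rec = complete_symmetric.simps(3)
  have "(x - y) * complete_symmetric (Suc k) (x # y # ys) =
     (x - y) * complete_symmetric (Suc k) (y # ys) +
     x * ((x - y) * complete_symmetric k (x # y # ys))"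
    unfolding rec[of k x "y # ys"] by (simp only: ring_distribs mult.left_commute)
  also have "\<dots> = (x - y) * complete_symmetric (Suc k) (y # ys) +
     x * (complete_symmetric (Suc k) (x # ys) - complete_symmetric (Suc k) (y # ys))"
    by (simp only: Suc.IH)
  also have "\<dots> = x * complete_symmetric (Suc k) (x # ys) - y * complete_symmetric (Suc k) (y # ys)"
    by (simp add: left_diff_distrib right_diff_distrib del: complete_symmetric.simps)
  also have "\<dots> = complete_symmetric (Suc (Suc k)) (x # ys) - complete_symmetric (Suc (Suc k)) (y # ys)"
    unfolding rec[of "Suc k"] by (simp del: complete_symmetric.simps)
  finally show ?case by simp
qed simp

lemma complete_symmetric_int_difference:
  "complete_symmetric_int k (x # ys) =
     complete_symmetric_int k (y # ys) + (x - y) * complete_symmetric_int (k - 1) (x # y # ys)"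
proof (cases "k \<ge> 1")
  case True
  then have "nat k = Suc (nat (k - 1))" by simp
  then show ?thesis
    using True complete_symmetric_difference[of "nat (k - 1)" x ys y]
    by (simp add: complete_symmetric_int_def algebra_simps)
next
  case False
  then show ?thesis by (cases "k = 0") (auto simp: complete_symmetric_int_def)
qed

text \<open>Newton interpolation of \<open>z ^ m\<close> with remainder. The nodes are added in the order
  \<open>x (n - 1)\<close>, \<open>x (n - 2)\<close>, ..., \<open>x k0\<close>, because this order makes both factors in the
  factorization of an alternant triangular for the staircase exponents.\<close>

lemma newton_interpolation_remainder:
  fixes z :: "'a :: comm_ring_1"
  assumes "k0 \<le> n"
  shows "z ^ m = (\<Sum>k = k0..<n. complete_symmetric_int (int m - int n + 1 + int k) (map x [k..<n]) *
            (\<Prod>l = Suc k..<n. z - x l)) +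
     complete_symmetric_int (int m - int n + int k0) (z # map x [k0..<n]) * (\<Prod>l = k0..<n. z - x l)"
  using assms
proof (induction k0 rule: inc_induct)
  case base
  then show ?case by (simp add: complete_symmetric_int_def complete_symmetric_single)
next
  case (step k)
  have upt: "[k..<n] = k # [Suc k..<n]" using step.hyps by (simp add: upt_conv_Cons)
  have split: "(\<Prod>l = k..<n. z - x l) = (z - x k) * (\<Prod>l = Suc k..<n. z - x l)"
    "(\<Sum>j = k..<n. g j) = g k + (\<Sum>j = Suc k..<n. g j)" for g :: "nat \<Rightarrow> 'a"
    using step.hyps by (auto simp: prod.atLeast_Suc_lessThan sum.atLeast_Suc_lessThan)
  have remainder: "complete_symmetric_int (int m - int n + int (Suc k)) (z # map x [Suc k..<n]) =
      complete_symmetric_int (int m - int n + 1 + int k) (map x [k..<n]) +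
      (z - x k) * complete_symmetric_int (int m - int n + int k) (z # map x [k..<n])"
    using complete_symmetric_int_difference[of "int m - int n + int (Suc k)" z "map x [Suc k..<n]" "x k"]
    by (simp add: upt algebra_simps)
  show ?case
    unfolding step.IH remainder split by (simp only: ring_distribs mult_ac add_ac)
qed

lemma newton_interpolation:
  fixes x :: "nat \<Rightarrow> 'a :: comm_ring_1"
  assumes "i < n"
  shows "x i ^ m = (\<Sum>k = 0..<n. (\<Prod>l = Suc k..<n. x i - x l) *
           complete_symmetric_int (int m - int n + 1 + int k) (map x [k..<n]))"
proof -
  have "(\<Prod>l = 0..<n. x i - x l) = 0"
    using assms by (intro prod_zero) auto
  then show ?thesis
    using newton_interpolation_remainder[of 0 n "x i" m x] by (simp add: mult.commute)
qed

text \<open>The divided differences of the powers with exponents \<open>\<alpha> j\<close> over the nodes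
  \<open>x k, ..., x (n - 1)\<close>.\<close>

definition newton_matrix :: "nat \<Rightarrow> (nat \<Rightarrow> int) \<Rightarrow> (nat \<Rightarrow> complex) \<Rightarrow> complex Matrix.mat" where
  "newton_matrix n \<alpha> x =
     Matrix.mat n n (\<lambda>(k, j). complete_symmetric_int (\<alpha> j - int n + 1 + int k) (map x [k..<n]))"

text \<open>Newton interpolation at the nodes themselves writes the matrix of powers as a product of an
  upper triangular matrix of products of differences and the matrix of divided differences. The
  shift \<open>s\<close> makes all exponents nonnegative and is undone by scaling the rows. Hence the
  Vandermonde product divides every alternant, with an explicit polynomial quotient.\<close>

lemma alternant_factorization:
  assumes x: "x \<in> nonzero_args n" and s: "\<And>j. j < n \<Longrightarrow> l ! j + s \<ge> 0"
  shows "alternant n l x = (\<Prod>k<n. x k powi (- s)) * (\<Prod>k<n. \<Prod>j = Suc k..<n. x k - x j) *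
     Determinant.det (newton_matrix n (\<lambda>j. l ! j + s + int n - 1 - int j) x)"
proof -
  define U where "U = Matrix.mat n n (\<lambda>(i, k). x i powi (- s) * (\<Prod>j = Suc k..<n. x i - x j))"
  define H where "H = newton_matrix n (\<lambda>j. l ! j + s + int n - 1 - int j) x"
  have U: "U \<in> carrier_mat n n" and H: "H \<in> carrier_mat n n"
    by (auto simp: U_def H_def newton_matrix_def)
  have "Matrix.mat n n (\<lambda>(i, j). x i powi (l ! j + int n - 1 - int j)) = U * H"
  proof (rule eq_matI)
    fix i j assume "i < dim_row (U * H)" "j < dim_col (U * H)"
    then have ij: "i < n" "j < n" using U H by auto
    define m where "m = nat (l ! j + s + int n - 1 - int j)"
    have m: "int m = l ! j + s + int n - 1 - int j"
      using s[OF ij(2)] ij unfolding m_def by simp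
    have "x i powi (l ! j + int n - 1 - int j) = x i powi (- s + int m)"
      by (simp add: m algebra_simps)
    also have "\<dots> = x i powi (- s) * x i ^ m"
      using x ij by (subst power_int_add) (auto simp: nonzero_args_def)
    also have "\<dots> = (U * H) $$ (i, j)"
      unfolding newton_interpolation[OF ij(1), of x m]
      using ij by (simp add: U_def H_def newton_matrix_def scalar_prod_def m sum_distrib_left mult.assoc)
    finally show "Matrix.mat n n (\<lambda>(i, j). x i powi (l ! j + int n - 1 - int j)) $$ (i, j) = (U * H) $$ (i, j)"
      using ij by simp
  qed (use U H in auto)
  then have "alternant n l x = Determinant.det U * Determinant.det H"
    unfolding alternant_def using det_mult[OF U H] by simp
  moreover have "upper_triangular U"
    using U by (auto simp: upper_triangular_def U_def intro!: prod_zero)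
  then have "Determinant.det U = (\<Prod>k<n. x k powi (- s)) * (\<Prod>k<n. \<Prod>j = Suc k..<n. x k - x j)"
    using U by (subst det_upper_triangular[OF _ U])
      (simp_all add: prod_list_diag_prod U_def prod.distrib lessThan_atLeast0)
  ultimately show ?thesis unfolding H_def by simp
qed

text \<open>For the staircase exponents \<open>n - 1 - j\<close> the entry at \<open>(k, j)\<close> has degree \<open>k - j\<close>, so the
  matrix is lower triangular with ones on the diagonal.\<close>

lemma det_newton_matrix_staircase:
  "Determinant.det (newton_matrix n (\<lambda>j. int n - 1 - int j) x) = 1"
proof -
  define M where "M = newton_matrix n (\<lambda>j. int n - 1 - int j) x"
  have M: "M \<in> carrier_mat n n" by (simp add: M_def newton_matrix_def)
  have e: "M $$ (k, j) = (if k < j then 0 else complete_symmetric (k - j) (map x [k..<n]))"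
    if "k < n" "j < n" for k j
    using that by (simp add: M_def newton_matrix_def complete_symmetric_int_def nat_diff_distrib)
  have "Determinant.det M = prod_list (diag_mat M)"
    by (rule det_lower_triangular[OF _ M]) (simp add: e)
  also have "\<dots> = 1"
    using M by (simp add: prod_list_diag_prod e)
  finally show ?thesis unfolding M_def .
qed

lemma alternant_zero:
  assumes "x \<in> nonzero_args n"
  shows "alternant n (replicate n 0) x = (\<Prod>k<n. \<Prod>j = Suc k..<n. x k - x j)"
proof -
  have "newton_matrix n (\<lambda>j. replicate n 0 ! j + 0 + int n - 1 - int j) x = newton_matrix n (\<lambda>j. int n - 1 - int j) x"
    by (auto simp: newton_matrix_def)
  then show ?thesis
    using alternant_factorization[OF assms, of "replicate n 0" 0]
    by (simp add: det_newton_matrix_staircase)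
qed

lemma alternant_zero_nonzero:
  assumes "x \<in> nonzero_args n" "inj_on x {..<n}"
  shows "alternant n (replicate n 0) x \<noteq> 0"
  by (auto simp: alternant_zero[OF assms(1)] dest!: inj_onD[OF assms(2)])

lemma laurent_polynomial_complete_symmetric:
  assumes "set is \<subseteq> {..<n}"
  shows "laurent_polynomial n (\<lambda>x. complete_symmetric k (map x is))"
  using assms
proof (induction k arbitrary: "is")
  case 0
  show ?case by (simp add: laurent_polynomial_const)
next
  case (Suc k)
  show ?case
    using Suc.prems
  proof (induction "is")
    case Nil
    show ?case by (simp add: laurent_polynomial_const)
  next
    case (Cons i "is")
    have "laurent_polynomial n (\<lambda>x. complete_symmetric (Suc k) (map x is) +
        x i powi 1 * complete_symmetric k (map x (i # is)))"
      using Cons Suc.IH[of "i # is"]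
      by (intro laurent_polynomial_add laurent_polynomial_mult laurent_polynomial_coord) simp_all
    then show ?case by simp
  qed
qed

lemma laurent_polynomial_newton_det:
  "laurent_polynomial n (\<lambda>x. Determinant.det (newton_matrix n \<alpha> x))"
  unfolding newton_matrix_def
proof (rule laurent_polynomial_det)
  fix k j
  show "laurent_polynomial n (\<lambda>x. complete_symmetric_int (\<alpha> j - int n + 1 + int k) (map x [k..<n]))"
    unfolding complete_symmetric_int_def
    by (cases "\<alpha> j - int n + 1 + int k < 0")
       (simp_all only: if_True if_False laurent_polynomial_const, rule laurent_polynomial_complete_symmetric, auto)
qed

lemma schur_exists:
  "\<exists>g. laurent_polynomial n g \<and> (\<forall>x\<in>nonzero_args n. inj_on x {..<n} \<longrightarrow>
        g x = alternant n l x / alternant n (replicate n 0) x)"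
proof -
  \<comment> \<open>any shift that makes all entries of \<open>l\<close> nonnegative would do\<close>
  define s where "s = (\<Sum>j<n. \<bar>l ! j\<bar>)"
  have s: "l ! j + s \<ge> 0" if "j < n" for j
    using member_le_sum[of j "{..<n}" "\<lambda>j. \<bar>l ! j\<bar>"] that unfolding s_def by auto
  define g where "g x = (\<Prod>k<n. x k powi (- s)) *
     Determinant.det (newton_matrix n (\<lambda>j. l ! j + s + int n - 1 - int j) x)" for x
  have "laurent_polynomial n g"
    unfolding g_def
    by (intro laurent_polynomial_mult laurent_polynomial_prod laurent_polynomial_newton_det)
       (auto intro: laurent_polynomial_coord)
  moreover have "g x = alternant n l x / alternant n (replicate n 0) x"
    if "x \<in> nonzero_args n" "inj_on x {..<n}" for x
    using alternant_zero_nonzero[OF that] alternant_factorization[OF that(1) s]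
    by (simp add: g_def alternant_zero[OF that(1)])
  ultimately show ?thesis by blast
qed

lemma laurent_polynomial_schur: "laurent_polynomial n (schur n l)"
  unfolding schur_def by (rule someI2_ex[OF schur_exists]) blast

lemma schur_mult_alternant_zero:
  assumes "x \<in> nonzero_args n" "inj_on x {..<n}"
  shows "schur n l x * alternant n (replicate n 0) x = alternant n l x"
proof -
  have "schur n l x = alternant n l x / alternant n (replicate n 0) x"
    unfolding schur_def by (rule someI2_ex[OF schur_exists]) (use assms in blast)
  then show ?thesis using alternant_zero_nonzero[OF assms] by simp
qed

lemma schur_zero:
  assumes "x \<in> nonzero_args n"
  shows "schur n (replicate n 0) x = 1"
proof (rule laurent_polynomial_eqI[OF laurent_polynomial_schur laurent_polynomial_const _ assms])
  fix y assume "y \<in> nonzero_args n" "inj_on y {..<n}"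
  then show "schur n (replicate n 0) y = 1"
    using schur_mult_alternant_zero[of y n "replicate n 0"] alternant_zero_nonzero[of y n] by simp
qed

section \<open>Decreasing and distinct integer vectors\<close>

text \<open>The vector \<open>l + \<delta>\<close> of the exponents in an alternant.\<close>

definition shifted_weight :: "nat \<Rightarrow> int list \<Rightarrow> int list" where
  "shifted_weight n l = map (\<lambda>j. l ! j + int n - 1 - int j) [0..<n]"

lemma length_shifted_weight [simp]: "length (shifted_weight n l) = n"
  by (simp add: shifted_weight_def)

lemma nth_shifted_weight [simp]:
  "j < n \<Longrightarrow> shifted_weight n l ! j = l ! j + int n - 1 - int j"
  by (simp add: shifted_weight_def)

lemma shifted_weight_bij:
  "bij_betw (shifted_weight n) (weights n) {g. length g = n \<and> sorted_wrt (>) g}"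
  unfolding bij_betw_def
proof
  show "inj_on (shifted_weight n) (weights n)"
  proof (intro inj_onI nth_equalityI)
    fix l m assume *: "l \<in> weights n" "m \<in> weights n" "shifted_weight n l = shifted_weight n m"
    show "length l = length m" using * by (simp add: weights_def)
    fix i assume "i < length l"
    then have "i < n" using * by (simp add: weights_def)
    then show "l ! i = m ! i" using arg_cong[OF *(3), of "\<lambda>g. g ! i"] by simp
  qed
next
  show "shifted_weight n ` weights n = {g. length g = n \<and> sorted_wrt (>) g}"
  proof (intro equalityI subsetI)
    fix g assume "g \<in> shifted_weight n ` weights n"
    then obtain l where l: "l \<in> weights n" "g = shifted_weight n l" by auto
    then show "g \<in> {g. length g = n \<and> sorted_wrt (>) g}"
      by (fastforce simp: weights_def sorted_wrt_iff_nth_less)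
  next
    fix g :: "int list" assume "g \<in> {g. length g = n \<and> sorted_wrt (>) g}"
    then have g: "length g = n" "sorted_wrt (>) g" by auto
    define l where "l = map (\<lambda>j. g ! j - int n + 1 + int j) [0..<n]"
    have "transp ((\<ge>) :: int \<Rightarrow> _)" by (auto intro: transpI)
    then have "sorted_wrt (\<ge>) l"
      using g by (subst sorted_wrt_iff_nth_Suc_transp)
        (force simp: l_def sorted_wrt_iff_nth_less)+
    moreover have "length l = n" by (simp add: l_def)
    ultimately have "l \<in> weights n" by (simp add: weights_def)
    moreover have "shifted_weight n l = g"
      by (rule nth_equalityI) (simp_all add: l_def g)
    ultimately show "g \<in> shifted_weight n ` weights n" by blast
  qed
qed

lemma permute_list_eq_imp_permutation_eq:
  assumes "distinct d" "p permutes {..<length d}" "q permutes {..<length d}"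
    and eq: "permute_list p d = permute_list q d"
  shows "p = q"
proof
  fix i
  show "p i = q i"
  proof (cases "i < length d")
    case True
    then have "d ! p i = d ! q i"
      using arg_cong[OF eq, of "\<lambda>g. g ! i"] assms(2,3) by (simp add: permute_list_nth)
    then show ?thesis
      using True assms(1) permutes_in_image[OF assms(2), of i] permutes_in_image[OF assms(3), of i]
      by (simp add: nth_eq_iff_index_eq)
  next
    case False
    then show ?thesis using assms(2,3) by (simp add: permutes_not_in)
  qed
qed

lemma strictly_decreasing_equal:
  fixes d d' :: "'a :: linorder list"
  assumes "sorted_wrt (>) d" "sorted_wrt (>) d'" "set d = set d'"
  shows "d = d'"
  using strict_sorted_equal[of "rev d'" "rev d"] assms by (simp add: sorted_wrt_rev)

text \<open>Sorting in decreasing order is the inverse map: it yields the only strictly decreasing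
  rearrangement of a vector of distinct integers, and because the entries are distinct, only one
  permutation achieves it.\<close>

lemma shifted_weight_permutations_bij:
  "bij_betw (\<lambda>(t, p). permute_list p (shifted_weight n t))
     (weights n \<times> {p. p permutes {..<n}}) {g. length g = n \<and> distinct g}"
  (is "bij_betw ?h ?D ?R")
  unfolding bij_betw_def
proof
  have dec: "sorted_wrt (>) (shifted_weight n t)" if "t \<in> weights n" for t
    using that bij_betwE[OF shifted_weight_bij] by blast
  have dist: "distinct (shifted_weight n t)" if "t \<in> weights n" for t
    using dec[OF that] strict_sorted_iff[of "rev (shifted_weight n t)"] by (simp add: sorted_wrt_rev)
  show "inj_on ?h ?D"
  proof (rule inj_onI, clarify)
    fix t p t' p' assume *: "t \<in> weights n" "t' \<in> weights n" "p permutes {..<n}" "p' permutes {..<n}"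
      "permute_list p (shifted_weight n t) = permute_list p' (shifted_weight n t')"
    have "set (shifted_weight n t) = set (shifted_weight n t')"
      using arg_cong[OF *(5), of set] *(3,4) by simp
    then have eq: "shifted_weight n t = shifted_weight n t'"
      using strictly_decreasing_equal dec *(1,2) by blast
    then have "t = t'"
      using *(1,2) shifted_weight_bij by (auto simp: bij_betw_def inj_on_def)
    moreover have "p = p'"
      using * eq dist by (intro permute_list_eq_imp_permutation_eq[of "shifted_weight n t"]) auto
    ultimately show "t = t' \<and> p = p'" by simp
  qed
  show "?h ` ?D = ?R"
  proof (intro equalityI subsetI)
    fix g assume "g \<in> ?h ` ?D"
    then show "g \<in> ?R" using dist by auto
  next
    fix g :: "int list" assume g: "g \<in> ?R"
    define d where "d = rev (sort g)"
    have "sorted_wrt (<) (sort g)" using g by (simp add: strict_sorted_iff)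
    then have "sorted_wrt (>) d" "length d = n" using g by (simp_all add: d_def sorted_wrt_rev)
    then have "d \<in> shifted_weight n ` weights n"
      using shifted_weight_bij[of n] by (simp add: bij_betw_def)
    then obtain t where t: "t \<in> weights n" "d = shifted_weight n t" by blast
    have "mset g = mset d" by (simp add: d_def)
    then obtain p where "p permutes {..<length d}" "permute_list p d = g"
      by (rule mset_eq_permutation)
    then have "g = ?h (t, p)" "(t, p) \<in> ?D" using t by auto
    then show "g \<in> ?h ` ?D" by blast
  qed
qed

text \<open>The reindexing that replaces a sum over weights and permutations by a sum over all integer
  vectors. It is used once for the monomials of a product of a Schur function with an alternant, and
  once for the Toeplitz minors in the main identity.\<close>

lemma sum_distinct_lists:
  fixes \<Phi> :: "int list \<Rightarrow> complex"
  assumes fin: "finite S" "{g. \<Phi> g \<noteq> 0} \<subseteq> S"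
    and supp: "\<And>g. \<Phi> g \<noteq> 0 \<Longrightarrow> length g = n \<and> distinct g"
    and W: "finite W" "W \<subseteq> weights n"
    and out: "\<And>t p. t \<in> weights n \<Longrightarrow> p permutes {..<n} \<Longrightarrow>
      \<Phi> (permute_list p (shifted_weight n t)) \<noteq> 0 \<Longrightarrow> t \<in> W"
  shows "(\<Sum>t\<in>W. \<Sum>p | p permutes {..<n}. \<Phi> (permute_list p (shifted_weight n t))) = (\<Sum>g\<in>S. \<Phi> g)"
proof -
  let ?h = "\<lambda>(t, p). permute_list p (shifted_weight n t)"
  let ?P = "{p. p permutes {..<n}}"
  have inj: "inj_on ?h (W \<times> ?P)"
    using shifted_weight_permutations_bij[of n] W(2) by (auto simp: bij_betw_def elim!: inj_on_subset)
  have "(\<Sum>t\<in>W. \<Sum>p\<in>?P. \<Phi> (permute_list p (shifted_weight n t))) = (\<Sum>k\<in>W \<times> ?P. \<Phi> (?h k))"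
    by (simp add: sum.cartesian_product case_prod_unfold)
  also have "\<dots> = (\<Sum>g\<in>?h ` (W \<times> ?P). \<Phi> g)"
    by (simp add: sum.reindex[OF inj])
  also have "\<dots> = (\<Sum>g | \<Phi> g \<noteq> 0. \<Phi> g)"
  proof (rule sum.mono_neutral_right)
    show "finite (?h ` (W \<times> ?P))"
      using W(1) by (intro finite_imageI finite_cartesian_product finite_permutations) auto
    show "{g. \<Phi> g \<noteq> 0} \<subseteq> ?h ` (W \<times> ?P)"
    proof
      fix g assume g: "g \<in> {g. \<Phi> g \<noteq> 0}"
      then have "g \<in> ?h ` (weights n \<times> ?P)"
        using supp shifted_weight_permutations_bij[of n] by (simp add: bij_betw_def)
      then obtain t p where "t \<in> weights n" "p permutes {..<n}" "g = permute_list p (shifted_weight n t)"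
        by auto
      with g out show "g \<in> ?h ` (W \<times> ?P)" by force
    qed
  qed auto
  also have "\<dots> = (\<Sum>g\<in>S. \<Phi> g)"
    using fin by (intro sum.mono_neutral_left) auto
  finally show ?thesis .
qed

lemma finite_weights_meeting:
  assumes "finite S"
  shows "finite {t \<in> weights n. \<exists>p. p permutes {..<n} \<and> permute_list p (shifted_weight n t) \<in> S}"
proof -
  let ?h = "\<lambda>(t, p). permute_list p (shifted_weight n t)"
  let ?D = "weights n \<times> {p. p permutes {..<n}}"
  have "finite (?h -` S \<inter> ?D)"
    using assms shifted_weight_permutations_bij[of n]
    by (intro finite_vimage_IntI) (auto simp: bij_betw_def)
  then have "finite (fst ` (?h -` S \<inter> ?D))" by (rule finite_imageI)
  then show ?thesis by (rule rev_finite_subset) (force simp: image_iff)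
qed

text \<open>Exchanging two equal entries changes the sign of \<open>\<Psi> g\<close> but not \<open>g\<close>.\<close>

lemma alternating_not_distinct:
  fixes \<Psi> :: "'a list \<Rightarrow> complex"
  assumes alt: "\<And>q. q permutes {..<length g} \<Longrightarrow> \<Psi> (permute_list q g) = of_int (sign q) * \<Psi> g"
    and "\<not> distinct g"
  shows "\<Psi> g = 0"
proof -
  obtain i j where ij: "i < length g" "j < length g" "i \<noteq> j" "g ! i = g ! j"
    using assms(2) by (auto simp: distinct_conv_nth)
  let ?q = "Transposition.transpose i j"
  have q: "?q permutes {..<length g}"
    using ij by (intro permutes_swap_id) auto
  have "permute_list ?q g = g"
    using ij q by (intro nth_equalityI) (auto simp: permute_list_nth Transposition.transpose_def)
  then have "\<Psi> g = - \<Psi> g"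
    using alt[OF q] ij by (simp add: sign_swap_id)
  then show ?thesis by simp
qed

text \<open>The permutation is moved into the vector \<open>b\<close>, so that for \<open>b = l + \<delta>\<close> alternants and Toeplitz
  minors are alternating sums over the same rearrangements.\<close>

lemma det_permutation_expansion:
  assumes "length b = n"
  shows "Determinant.det (Matrix.mat n n (\<lambda>(i, j). u (b ! i) j)) =
    (\<Sum>p | p permutes {..<n}. of_int (sign p) * (\<Prod>j<n. u (permute_list p b ! j) j))"
  by (subst det_col[of _ n])
     (auto simp: lessThan_atLeast0 permutes_in_image permute_list_nth assms intro!: sum.cong prod.cong)

lemma det_permute_argument:
  fixes g :: "'b list" and u :: "nat \<Rightarrow> 'b \<Rightarrow> 'c :: comm_ring_1"
  assumes "length g = n" "q permutes {..<n}"
  shows "Determinant.det (Matrix.mat n n (\<lambda>(i, j). u i (permute_list q g ! j))) =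
    of_int (sign q) * Determinant.det (Matrix.mat n n (\<lambda>(i, j). u i (g ! j)))"
proof -
  have tr: "Determinant.det (Matrix.mat n n (\<lambda>(i, j). u i (g ! j))) =
      Determinant.det (Matrix.mat n n (\<lambda>(j, i). u i (g ! j)))" for g :: "'b list"
    by (subst det_transpose[symmetric, of _ n])
       (auto intro!: arg_cong[of _ _ Determinant.det])
  have q: "q permutes {0..<n}" using assms(2) by (simp add: lessThan_atLeast0)
  have "Matrix.mat n n (\<lambda>(j, i). u i (permute_list q g ! j)) =
      Matrix.mat n n (\<lambda>(j, i). Matrix.mat n n (\<lambda>(j, i). u i (g ! j)) $$ (q j, i))"
    using assms q by (intro cong_mat) (auto simp: permute_list_nth permutes_in_image)
  then show ?thesis
    unfolding tr using det_permute_rows[OF _ q, of "Matrix.mat n n (\<lambda>(j, i). u i (g ! j))"] by simp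
qed

lemma alternant_expansion:
  "alternant n l x =
    (\<Sum>p | p permutes {..<n}. of_int (sign p) * laurent_monomial n (permute_list p (shifted_weight n l)) x)"
proof -
  have "Determinant.det (Matrix.mat n n (\<lambda>(i, j). x i powi (l ! j + int n - 1 - int j))) =
      Determinant.det (Matrix.mat n n (\<lambda>(i, j). x j powi (shifted_weight n l ! i)))"
    by (subst det_transpose[symmetric, of _ n])
       (auto intro!: arg_cong[of _ _ Determinant.det])
  then show ?thesis
    unfolding alternant_def laurent_monomial_def
    by (simp only: det_permutation_expansion[OF length_shifted_weight, of n "\<lambda>b j. x j powi b"])
qed

section \<open>Littlewood-Richardson coefficients as alternating sums\<close>

text \<open>The coefficient of \<open>x ^ e\<close> in \<open>s\<^sub>l\<close>, which for a weight \<open>l\<close> is a weight multiplicity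
  of the irreducible representation with highest weight \<open>l\<close>.\<close>

definition schur_coeff :: "nat \<Rightarrow> int list \<Rightarrow> int list \<Rightarrow> complex" where
  "schur_coeff n l = (SOME K. finite {e. K e \<noteq> 0} \<and> (\<forall>e. K e \<noteq> 0 \<longrightarrow> length e = n) \<and>
     (\<forall>x\<in>nonzero_args n. schur n l x = (\<Sum>e | K e \<noteq> 0. K e * laurent_monomial n e x)))"

lemma schur_coeff_spec:
  "finite {e. schur_coeff n l e \<noteq> 0} \<and> (\<forall>e. schur_coeff n l e \<noteq> 0 \<longrightarrow> length e = n) \<and>
     (\<forall>x\<in>nonzero_args n. schur n l x =
        (\<Sum>e | schur_coeff n l e \<noteq> 0. schur_coeff n l e * laurent_monomial n e x))"
proof -
  obtain E a where E: "finite E" "\<And>e. e \<in> E \<Longrightarrow> length e = n"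
    "\<And>x. x \<in> nonzero_args n \<Longrightarrow> schur n l x = (\<Sum>e\<in>E. a e * laurent_monomial n e x)"
    using laurent_polynomialE[OF laurent_polynomial_schur] by metis
  define K where "K e = (if e \<in> E then a e else 0)" for e
  have sub: "{e. K e \<noteq> 0} \<subseteq> E" by (auto simp: K_def)
  have "(\<Sum>e\<in>E. a e * laurent_monomial n e x) = (\<Sum>e | K e \<noteq> 0. K e * laurent_monomial n e x)" for x
    using E(1) sub by (intro sum.mono_neutral_cong_right) (auto simp: K_def)
  then have "\<exists>K. finite {e. K e \<noteq> 0} \<and> (\<forall>e. K e \<noteq> 0 \<longrightarrow> length e = n) \<and>
     (\<forall>x\<in>nonzero_args n. schur n l x = (\<Sum>e | K e \<noteq> 0. K e * laurent_monomial n e x))"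
    using E sub by (intro exI[of _ K]) (auto intro: finite_subset)
  from someI_ex[OF this] show ?thesis unfolding schur_coeff_def .
qed

lemmas finite_schur_coeff = schur_coeff_spec[THEN conjunct1]
lemmas length_schur_coeff = schur_coeff_spec[THEN conjunct2, THEN conjunct1, rule_format]
lemmas schur_expansion = schur_coeff_spec[THEN conjunct2, THEN conjunct2, rule_format]

lemma permute_list_inv:
  assumes "p permutes {..<length e}"
  shows "permute_list (Hilbert_Choice.inv p) (permute_list p e) = e"
    "permute_list p (permute_list (Hilbert_Choice.inv p) e) = e"
  using assms permutes_inv[OF assms]
  by (simp_all add: permutes_inv_o flip: permute_list_compose)

lemma laurent_monomial_permute:
  assumes "p permutes {..<n}" "length e = n"
  shows "laurent_monomial n (permute_list p e) (x \<circ> p) = laurent_monomial n e x"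
  unfolding laurent_monomial_def
  using prod.permute[OF assms(1), of "\<lambda>i. x i powi (e ! i)"] assms
  by (auto simp: permute_list_nth o_def intro!: prod.cong)

lemma permuted_args:
  assumes "p permutes {..<n}" "x \<in> nonzero_args n" "inj_on x {..<n}"
  shows "x \<circ> p \<in> nonzero_args n" "inj_on (x \<circ> p) {..<n}"
proof -
  show "x \<circ> p \<in> nonzero_args n"
    using assms(2) permutes_in_image[OF assms(1)] by (auto simp: nonzero_args_def)
  show "inj_on (x \<circ> p) {..<n}"
    using assms by (intro comp_inj_on) (simp_all add: permutes_image permutes_inj_on)
qed

lemma alternant_permute:
  assumes "p permutes {..<n}"
  shows "alternant n l (x \<circ> p) = of_int (sign p) * alternant n l x"
proof -
  have p: "p permutes {0..<n}" using assms by (simp add: lessThan_atLeast0)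
  have "Matrix.mat n n (\<lambda>(i, j). (x \<circ> p) i powi (l ! j + int n - 1 - int j)) =
      Matrix.mat n n (\<lambda>(i, j). Matrix.mat n n (\<lambda>(i, j). x i powi (l ! j + int n - 1 - int j)) $$ (p i, j))"
    using p by (intro cong_mat) (auto simp: permutes_in_image)
  then show ?thesis
    unfolding alternant_def
    using det_permute_rows[OF _ p, of "Matrix.mat n n (\<lambda>(i, j). x i powi (l ! j + int n - 1 - int j))"]
    by simp
qed

text \<open>Numerator and denominator of the bialternant quotient change by the same sign.\<close>

lemma schur_permute:
  assumes "p permutes {..<n}" "x \<in> nonzero_args n" "inj_on x {..<n}"
  shows "schur n l (x \<circ> p) = schur n l x"
proof -
  have "of_int (sign p) * (schur n l (x \<circ> p) * alternant n (replicate n 0) x) =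
      of_int (sign p) * (schur n l x * alternant n (replicate n 0) x)"
    using schur_mult_alternant_zero[OF permuted_args[OF assms], of l]
      schur_mult_alternant_zero[OF assms(2,3), of l]
    by (simp add: alternant_permute[OF assms(1)] mult.left_commute)
  then show ?thesis
    using alternant_zero_nonzero[OF assms(2,3)] by (simp add: sign_def split: if_splits)
qed

text \<open>The symmetry of the function passes to its coefficients, since these are determined by
  the values.\<close>

lemma schur_coeff_permute:
  assumes p: "p permutes {..<n}" and len: "length e = n"
  shows "schur_coeff n l (permute_list p e) = schur_coeff n l e"
proof -
  let ?S = "{e. schur_coeff n l e \<noteq> 0}"
  have "(\<Sum>d\<in>?S. schur_coeff n l d * (if permute_list p d = permute_list p e then 1 else 0)) =
        (\<Sum>d\<in>?S. schur_coeff n l d * (if d = permute_list p e then 1 else (0 :: complex)))"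
  proof (rule laurent_functional_eq[where n = n and \<phi> = "\<lambda>d. if d = permute_list p e then 1 else 0"])
    fix x assume x: "x \<in> nonzero_args n" "inj_on x {..<n}"
    note ip = permutes_inv[OF p]
    let ?y = "x \<circ> Hilbert_Choice.inv p"
    have y: "?y \<circ> p = x"
      using permutes_inv_o(2)[OF p] by (simp add: o_assoc[symmetric])
    have "(\<Sum>d\<in>?S. schur_coeff n l d * laurent_monomial n (permute_list p d) x) =
        (\<Sum>d\<in>?S. schur_coeff n l d * laurent_monomial n d ?y)"
      using laurent_monomial_permute[OF p, of _ ?y] length_schur_coeff[of n l] unfolding y
      by (intro sum.cong) auto
    also have "\<dots> = schur n l ?y"
      using schur_expansion permuted_args(1)[OF ip x] by simp
    also have "\<dots> = schur n l x" by (rule schur_permute[OF ip x])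
    also have "\<dots> = (\<Sum>d\<in>?S. schur_coeff n l d * laurent_monomial n d x)"
      by (rule schur_expansion[OF x(1)])
    finally show "(\<Sum>d\<in>?S. schur_coeff n l d * laurent_monomial n (permute_list p d) x) =
       (\<Sum>d\<in>?S. schur_coeff n l d * laurent_monomial n d x)" .
  qed (use finite_schur_coeff length_schur_coeff in auto)
  moreover have "(\<Sum>d\<in>?S. schur_coeff n l d * (if permute_list p d = permute_list p e then 1 else 0)) =
      (\<Sum>d\<in>?S. if d = e then schur_coeff n l d else 0)"
  proof (intro sum.cong refl)
    fix d assume "d \<in> ?S"
    then have "length d = n" using length_schur_coeff by blast
    then have "permute_list p d = permute_list p e \<longleftrightarrow> d = e"
      using permute_list_inv[of p d] permute_list_inv[of p e] p len by metis
    then show "schur_coeff n l d * (if permute_list p d = permute_list p e then 1 else 0) =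
      (if d = e then schur_coeff n l d else 0)" by simp
  qed
  moreover have "(\<Sum>d\<in>?S. schur_coeff n l d * (if d = permute_list p e then 1 else 0)) =
      (\<Sum>d\<in>?S. if d = permute_list p e then schur_coeff n l d else 0)"
    by (intro sum.cong) auto
  ultimately show ?thesis
    using finite_schur_coeff[of n l] by (simp add: sum.delta' split: if_splits)
qed

text \<open>The coefficient of \<open>x ^ g\<close> in the product of \<open>s\<^sub>l\<close> with the alternant of \<open>m\<close>.\<close>

definition schur_alternant_coeff :: "nat \<Rightarrow> int list \<Rightarrow> int list \<Rightarrow> int list \<Rightarrow> complex" where
  "schur_alternant_coeff n l m g = (if length g = n then
     (\<Sum>p | p permutes {..<n}. of_int (sign p) *
        schur_coeff n l (map2 (-) g (permute_list p (shifted_weight n m)))) else 0)"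

lemma map2_minus_permute:
  fixes g h :: "int list"
  assumes "length g = n" "length h = n" "q permutes {..<n}"
  shows "map2 (-) (permute_list q g) (permute_list q h) = permute_list q (map2 (-) g h)"
  using assms permutes_in_image[OF assms(3)]
  by (intro nth_equalityI) (auto simp: permute_list_nth)

lemma finite_translates:
  assumes "finite (S :: int list set)"
  shows "finite {g :: int list. length g = n \<and>
    (\<exists>p. p permutes {..<n} \<and> map2 (-) g (permute_list p (shifted_weight n m)) \<in> S)}"
proof -
  have "finite (\<Union>p\<in>{p. p permutes {..<n}}. (\<lambda>e. map2 (+) e (permute_list p (shifted_weight n m))) ` S)"
    using assms by (intro finite_UN_I finite_permutations finite_imageI) auto
  moreover have "{g. length g = n \<and> (\<exists>p. p permutes {..<n} \<and> map2 (-) g (permute_list p (shifted_weight n m)) \<in> S)}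
    \<subseteq> (\<Union>p\<in>{p. p permutes {..<n}}. (\<lambda>e. map2 (+) e (permute_list p (shifted_weight n m))) ` S)"
  proof clarify
    fix g :: "int list" and p assume *: "n = length g" "p permutes {..<length g}"
      "map2 (-) g (permute_list p (shifted_weight (length g) m)) \<in> S"
    have "g = map2 (+) (map2 (-) g (permute_list p (shifted_weight (length g) m))) (permute_list p (shifted_weight (length g) m))"
      by (rule nth_equalityI) auto
    then show "g \<in> (\<Union>p\<in>{p. p permutes {..<length g}}. (\<lambda>e. map2 (+) e (permute_list p (shifted_weight (length g) m))) ` S)"
      using * by blast
  qed
  ultimately show ?thesis by (rule rev_finite_subset)
qed

lemma schur_alternant_coeff_nonzeroD:
  assumes "schur_alternant_coeff n l m g \<noteq> 0"
  shows "length g = n"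
    "\<exists>p. p permutes {..<n} \<and> map2 (-) g (permute_list p (shifted_weight n m)) \<in> {e. schur_coeff n l e \<noteq> 0}"
proof -
  show len: "length g = n" using assms by (auto simp: schur_alternant_coeff_def split: if_splits)
  have "(\<Sum>p | p permutes {..<n}. of_int (sign p) *
        schur_coeff n l (map2 (-) g (permute_list p (shifted_weight n m)))) \<noteq> 0"
    using assms len by (simp add: schur_alternant_coeff_def)
  then show "\<exists>p. p permutes {..<n} \<and> map2 (-) g (permute_list p (shifted_weight n m)) \<in> {e. schur_coeff n l e \<noteq> 0}"
    by (force dest: sum.not_neutral_contains_not_neutral)
qed

lemma finite_schur_alternant_coeff: "finite {g. schur_alternant_coeff n l m g \<noteq> 0}"
  by (rule finite_subset[OF _ finite_translates[OF finite_schur_coeff[of n l], of n m]])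
     (use schur_alternant_coeff_nonzeroD in blast)

lemma schur_mult_alternant:
  assumes x: "x \<in> nonzero_args n"
  shows "schur n l x * alternant n m x =
    (\<Sum>g | schur_alternant_coeff n l m g \<noteq> 0. schur_alternant_coeff n l m g * laurent_monomial n g x)"
proof -
  let ?S = "{e. schur_coeff n l e \<noteq> 0}" and ?P = "{p. p permutes {..<n}}"
  let ?b = "\<lambda>p. permute_list p (shifted_weight n m)"
  \<comment> \<open>a finite set that contains all exponents of the product, so that the sums can be interchanged\<close>
  define G where "G = {g. length g = n \<and> (\<exists>p. p permutes {..<n} \<and> map2 (-) g (?b p) \<in> ?S)}"
  have G: "finite G" unfolding G_def by (rule finite_translates[OF finite_schur_coeff])
  have translate: "schur n l x * laurent_monomial n (?b p) x =
      (\<Sum>g\<in>G. schur_coeff n l (map2 (-) g (?b p)) * laurent_monomial n g x)" if p: "p \<in> ?P" for p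
  proof -
    have "schur n l x * laurent_monomial n (?b p) x =
        (\<Sum>e\<in>?S. schur_coeff n l e * laurent_monomial n (map2 (+) e (?b p)) x)"
      unfolding schur_expansion[OF x] sum_distrib_right
      using length_schur_coeff[of n l] x by (intro sum.cong) (auto simp: laurent_monomial_add)
    also have "\<dots> = (\<Sum>g | g \<in> G \<and> map2 (-) g (?b p) \<in> ?S.
        schur_coeff n l (map2 (-) g (?b p)) * laurent_monomial n g x)"
    proof (rule sum.reindex_bij_witness[where j = "\<lambda>e. map2 (+) e (?b p)" and i = "\<lambda>g. map2 (-) g (?b p)"])
      fix e assume e: "e \<in> ?S"
      then have len: "length e = n" using length_schur_coeff by blast
      then show 1: "map2 (-) (map2 (+) e (?b p)) (?b p) = e"
        by (intro nth_equalityI) auto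
      have 2: "map2 (-) (map2 (+) e (?b p)) (?b p) \<in> ?S" using e by (simp only: 1)
      moreover have "length (map2 (+) e (?b p)) = n" using len by simp
      ultimately show "map2 (+) e (?b p) \<in> {g \<in> G. map2 (-) g (?b p) \<in> ?S}"
        using p unfolding G_def by blast
      show "schur_coeff n l (map2 (-) (map2 (+) e (?b p)) (?b p)) * laurent_monomial n (map2 (+) e (?b p)) x =
          schur_coeff n l e * laurent_monomial n (map2 (+) e (?b p)) x"
        by (simp only: 1)
    next
      fix g assume "g \<in> {g \<in> G. map2 (-) g (?b p) \<in> ?S}"
      then show "map2 (+) (map2 (-) g (?b p)) (?b p) = g"
        by (intro nth_equalityI) (auto simp: G_def)
    qed auto
    also have "\<dots> = (\<Sum>g\<in>G. schur_coeff n l (map2 (-) g (?b p)) * laurent_monomial n g x)"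
      using G by (intro sum.mono_neutral_left) auto
    finally show ?thesis .
  qed
  have "schur n l x * alternant n m x =
      (\<Sum>p\<in>?P. of_int (sign p) * (schur n l x * laurent_monomial n (?b p) x))"
    unfolding alternant_expansion sum_distrib_left by (simp add: mult_ac)
  also have "\<dots> = (\<Sum>p\<in>?P. \<Sum>g\<in>G. of_int (sign p) * schur_coeff n l (map2 (-) g (?b p)) * laurent_monomial n g x)"
    using translate by (intro sum.cong) (auto simp: sum_distrib_left mult.assoc)
  also have "\<dots> = (\<Sum>g\<in>G. schur_alternant_coeff n l m g * laurent_monomial n g x)"
    by (subst sum.swap) (auto simp: schur_alternant_coeff_def G_def sum_distrib_right intro!: sum.cong)
  also have "\<dots> = (\<Sum>g | schur_alternant_coeff n l m g \<noteq> 0. schur_alternant_coeff n l m g * laurent_monomial n g x)"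
  proof (rule sum.mono_neutral_right[OF G])
    show "{g. schur_alternant_coeff n l m g \<noteq> 0} \<subseteq> G"
      unfolding G_def using schur_alternant_coeff_nonzeroD[of n l m] by auto
  qed auto
  finally show ?thesis .
qed

lemma sign_compose_permutes:
  assumes "p permutes {..<n :: nat}" "q permutes {..<n}"
  shows "sign (p \<circ> q) = sign p * sign q"
  using assms by (intro sign_compose permutes_imp_permutation[of "{..<n}"]) auto

text \<open>A symmetric function times an alternating one is alternating. On coefficients, the permutation \<open>q\<close>
  is absorbed by replacing \<open>p\<close> with \<open>p \<circ> q\<close> in the defining sum.\<close>

lemma schur_alternant_coeff_permute:
  assumes q: "q permutes {..<n}" and len: "length g = n"
  shows "schur_alternant_coeff n l m (permute_list q g) = of_int (sign q) * schur_alternant_coeff n l m g"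
proof -
  let ?P = "{p. p permutes {..<n}}"
  let ?b = "\<lambda>p. permute_list p (shifted_weight n m)"
  have "schur_alternant_coeff n l m (permute_list q g) =
      (\<Sum>p\<in>?P. of_int (sign p) * schur_coeff n l (map2 (-) (permute_list q g) (?b p)))"
    using len by (simp add: schur_alternant_coeff_def)
  also have "\<dots> = (\<Sum>p\<in>?P. of_int (sign (p \<circ> q)) * schur_coeff n l (map2 (-) (permute_list q g) (?b (p \<circ> q))))"
    by (rule sum_permutations_compose_right[OF q])
  also have "\<dots> = (\<Sum>p\<in>?P. of_int (sign q) * (of_int (sign p) * schur_coeff n l (map2 (-) g (?b p))))"
  proof (intro sum.cong refl)
    fix p assume p: "p \<in> ?P"
    have "?b (p \<circ> q) = permute_list q (?b p)"
      using q by (intro permute_list_compose) simp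
    then have "map2 (-) (permute_list q g) (?b (p \<circ> q)) = permute_list q (map2 (-) g (?b p))"
      using map2_minus_permute[OF len _ q, of "?b p"] by simp
    then show "of_int (sign (p \<circ> q)) * schur_coeff n l (map2 (-) (permute_list q g) (?b (p \<circ> q))) =
        of_int (sign q) * (of_int (sign p) * schur_coeff n l (map2 (-) g (?b p)))"
      using p q len by (simp add: sign_compose_permutes[of p n q] schur_coeff_permute)
  qed
  also have "\<dots> = of_int (sign q) * schur_alternant_coeff n l m g"
    using len by (simp add: schur_alternant_coeff_def sum_distrib_left)
  finally show ?thesis .
qed

text \<open>The Racah-Speiser (or Brauer) formula for tensor product multiplicities; on weights it
  coincides with the Littlewood-Richardson coefficient.\<close>

definition racah_speiser_coeff :: "nat \<Rightarrow> int list \<Rightarrow> int list \<Rightarrow> int list \<Rightarrow> complex" where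
  "racah_speiser_coeff n l m t = (if t \<in> weights n then schur_alternant_coeff n l m (shifted_weight n t) else 0)"

lemma finite_racah_speiser_coeff: "finite {t. racah_speiser_coeff n l m t \<noteq> 0}"
proof (rule finite_subset[OF _ finite_weights_meeting[OF finite_schur_alternant_coeff[of n l m], of n]])
  show "{t. racah_speiser_coeff n l m t \<noteq> 0} \<subseteq> {t \<in> weights n. \<exists>p. p permutes {..<n} \<and>
      permute_list p (shifted_weight n t) \<in> {g. schur_alternant_coeff n l m g \<noteq> 0}}"
    by (auto simp: racah_speiser_coeff_def permutes_id intro!: exI[of _ id] split: if_splits)
qed

text \<open>An alternating Laurent polynomial is a combination of alternants. The coefficient at \<open>t\<close> is
  the coefficient of the strictly decreasing exponent \<open>t + \<delta>\<close>; the exponents with a repeated entry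
  contribute nothing, and each remaining one is a rearrangement of such a \<open>t + \<delta>\<close>.\<close>

lemma alternant_product_expansion:
  assumes x: "x \<in> nonzero_args n"
  shows "schur n l x * alternant n m x = (\<Sum>t | racah_speiser_coeff n l m t \<noteq> 0. racah_speiser_coeff n l m t * alternant n t x)"
proof -
  let ?W = "{t. racah_speiser_coeff n l m t \<noteq> 0}" and ?P = "{p. p permutes {..<n}}"
  let ?\<Phi> = "\<lambda>g. schur_alternant_coeff n l m g * laurent_monomial n g x"
  have W: "?W \<subseteq> weights n" by (auto simp: racah_speiser_coeff_def split: if_splits)
  have "(\<Sum>t\<in>?W. racah_speiser_coeff n l m t * alternant n t x) =
      (\<Sum>t\<in>?W. \<Sum>p\<in>?P. ?\<Phi> (permute_list p (shifted_weight n t)))"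
    unfolding alternant_expansion sum_distrib_left using W
    by (intro sum.cong refl) (auto simp: schur_alternant_coeff_permute racah_speiser_coeff_def)
  also have "\<dots> = (\<Sum>g | schur_alternant_coeff n l m g \<noteq> 0. ?\<Phi> g)"
  proof (rule sum_distinct_lists[OF finite_schur_alternant_coeff _ _ finite_racah_speiser_coeff W])
    fix g assume "?\<Phi> g \<noteq> 0"
    then have "schur_alternant_coeff n l m g \<noteq> 0" by simp
    moreover from this have "length g = n" by (rule schur_alternant_coeff_nonzeroD)
    moreover from calculation have "distinct g"
      using alternating_not_distinct[of g "schur_alternant_coeff n l m"] schur_alternant_coeff_permute by blast
    ultimately show "length g = n \<and> distinct g" by simp
  next
    fix t p assume "t \<in> weights n" "p permutes {..<n}" "?\<Phi> (permute_list p (shifted_weight n t)) \<noteq> 0"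
    then show "t \<in> ?W" by (simp add: schur_alternant_coeff_permute racah_speiser_coeff_def)
  qed auto
  finally show ?thesis unfolding schur_mult_alternant[OF x] by simp
qed

text \<open>Cancelling the Vandermonde determinant is possible at points with distinct coordinates, which
  suffices for Laurent polynomials.\<close>

lemma schur_product_expansion:
  assumes x: "x \<in> nonzero_args n"
  shows "schur n l x * schur n m x = (\<Sum>t | racah_speiser_coeff n l m t \<noteq> 0. racah_speiser_coeff n l m t * schur n t x)"
proof (rule laurent_polynomial_eqI[OF _ _ _ x])
  fix y assume y: "y \<in> nonzero_args n" "inj_on y {..<n}"
  have "schur n l y * schur n m y * alternant n (replicate n 0) y = schur n l y * alternant n m y"
    by (simp add: mult.assoc schur_mult_alternant_zero[OF y])
  also have "\<dots> = (\<Sum>t | racah_speiser_coeff n l m t \<noteq> 0. racah_speiser_coeff n l m t * alternant n t y)"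
    by (rule alternant_product_expansion[OF y(1)])
  also have "\<dots> = (\<Sum>t | racah_speiser_coeff n l m t \<noteq> 0. racah_speiser_coeff n l m t * schur n t y) * alternant n (replicate n 0) y"
    by (simp add: mult.assoc sum_distrib_right schur_mult_alternant_zero[OF y])
  finally show "schur n l y * schur n m y = (\<Sum>t | racah_speiser_coeff n l m t \<noteq> 0. racah_speiser_coeff n l m t * schur n t y)"
    using alternant_zero_nonzero[OF y] by simp
qed (intro laurent_polynomial_mult laurent_polynomial_sum laurent_polynomial_const laurent_polynomial_schur)+

text \<open>After multiplication with the Vandermonde determinant, the combination becomes one of alternants,
  in which the monomial \<open>x\<close> to the power \<open>t + \<delta>\<close> occurs only in the alternant of \<open>t\<close>, and there only for
  the identity permutation.\<close>

lemma schur_linearly_independent: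
  assumes fin: "finite T" "T \<subseteq> weights n"
    and zero: "\<And>x. x \<in> nonzero_args n \<Longrightarrow> (\<Sum>t\<in>T. c t * schur n t x) = 0"
    and t: "t \<in> T"
  shows "c t = 0"
proof -
  let ?P = "{p. p permutes {..<n}}"
  let ?h = "\<lambda>(t, p). permute_list p (shifted_weight n t)"
  have P: "finite ?P" by (simp add: finite_permutations)
  have "(\<Sum>k\<in>T \<times> ?P. (case k of (t, p) \<Rightarrow> c t * of_int (sign p)) *
      (if ?h k = shifted_weight n t then 1 else 0)) = 0"
  proof (rule laurent_functional_zero[where n = n and \<phi> = "\<lambda>g. if g = shifted_weight n t then 1 else 0"])
    fix x assume x: "x \<in> nonzero_args n" "inj_on x {..<n}"
    have "0 = (\<Sum>t\<in>T. c t * schur n t x) * alternant n (replicate n 0) x"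
      using zero[OF x(1)] by simp
    also have "\<dots> = (\<Sum>t\<in>T. c t * alternant n t x)"
      by (simp add: sum_distrib_right mult.assoc schur_mult_alternant_zero[OF x])
    also have "\<dots> = (\<Sum>k\<in>T \<times> ?P. (case k of (t, p) \<Rightarrow> c t * of_int (sign p)) * laurent_monomial n (?h k) x)"
      unfolding alternant_expansion sum_distrib_left sum.cartesian_product
      by (intro sum.cong) auto
    finally show "(\<Sum>k\<in>T \<times> ?P. (case k of (t, p) \<Rightarrow> c t * of_int (sign p)) * laurent_monomial n (?h k) x) = 0"
      by simp
  qed (use fin P in auto)
  also have "(\<Sum>k\<in>T \<times> ?P. (case k of (t, p) \<Rightarrow> c t * of_int (sign p)) *
      (if ?h k = shifted_weight n t then 1 else 0)) =
      (\<Sum>k\<in>T \<times> ?P. if k = (t, id) then c t else 0)"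
  proof (intro sum.cong refl)
    fix k assume k: "k \<in> T \<times> ?P"
    have "?h k = shifted_weight n t \<longleftrightarrow> ?h k = ?h (t, id)" by simp
    also have "\<dots> \<longleftrightarrow> k = (t, id)"
      using shifted_weight_permutations_bij[of n] k t fin(2)
      unfolding bij_betw_def by (intro inj_on_eq_iff[of ?h "weights n \<times> ?P"]) (auto simp: permutes_id)
    finally show "(case k of (t, p) \<Rightarrow> c t * of_int (sign p)) * (if ?h k = shifted_weight n t then 1 else 0) =
        (if k = (t, id) then c t else 0)"
      by auto
  qed
  also have "\<dots> = c t"
    using fin P t by (simp add: permutes_id)
  finally show ?thesis by simp
qed

lemma LR_coeff_eq: "LR_coeff n l m = racah_speiser_coeff n l m"
  unfolding LR_coeff_def
proof (rule the_equality)
  show "finite {t. racah_speiser_coeff n l m t \<noteq> 0} \<and> {t. racah_speiser_coeff n l m t \<noteq> 0} \<subseteq> weights n \<and>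
    (\<forall>x\<in>nonzero_args n. schur n l x * schur n m x =
       (\<Sum>t | racah_speiser_coeff n l m t \<noteq> 0. racah_speiser_coeff n l m t * schur n t x))"
    using finite_racah_speiser_coeff schur_product_expansion
    by (auto simp: racah_speiser_coeff_def split: if_splits)
next
  fix c assume c: "finite {t. c t \<noteq> 0} \<and> {t. c t \<noteq> 0} \<subseteq> weights n \<and>
    (\<forall>x\<in>nonzero_args n. schur n l x * schur n m x = (\<Sum>t | c t \<noteq> 0. c t * schur n t x))"
  let ?d = "racah_speiser_coeff n l m"
  define T where "T = {t. c t \<noteq> 0} \<union> {t. ?d t \<noteq> 0}"
  have T: "finite T" "T \<subseteq> weights n"
    using c finite_racah_speiser_coeff by (auto simp: T_def racah_speiser_coeff_def split: if_splits)
  have "(\<Sum>t\<in>T. (c t - ?d t) * schur n t x) = 0" if x: "x \<in> nonzero_args n" for x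
  proof -
    have "(\<Sum>t\<in>T. c t * schur n t x) = (\<Sum>t | c t \<noteq> 0. c t * schur n t x)"
      using T(1) by (intro sum.mono_neutral_right) (auto simp: T_def)
    moreover have "(\<Sum>t\<in>T. ?d t * schur n t x) = (\<Sum>t | ?d t \<noteq> 0. ?d t * schur n t x)"
      using T(1) by (intro sum.mono_neutral_right) (auto simp: T_def)
    ultimately show ?thesis
      using c x schur_product_expansion[OF x, of l m] by (simp add: left_diff_distrib sum_subtractf)
  qed
  then have "c t - ?d t = 0" if "t \<in> T" for t
    using schur_linearly_independent[OF T, of "\<lambda>t. c t - ?d t"] that by blast
  then have "c t = ?d t" for t by (cases "t \<in> T") (auto simp: T_def)
  then show "c = ?d" by (rule ext)
qed

section \<open>Toeplitz minors\<close>

definition toeplitz_minor :: "nat \<Rightarrow> (int \<Rightarrow> 'a :: comm_ring_1) \<Rightarrow> int list \<Rightarrow> int list \<Rightarrow> 'a" where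
  "toeplitz_minor n f l m =
     Determinant.det (Matrix.mat n n (\<lambda>(i, j). f (l ! i - int i - m ! j + int j)))"

lemma toeplitz_minor_shifted:
  "toeplitz_minor n f l m =
     Determinant.det (Matrix.mat n n (\<lambda>(i, j). f (shifted_weight n l ! i - shifted_weight n m ! j)))"
  unfolding toeplitz_minor_def
  by (intro arg_cong[of _ _ Determinant.det] cong_mat) (auto intro!: arg_cong[of _ _ f])

lemma toeplitz_minor_expansion:
  "toeplitz_minor n f l m = (\<Sum>p | p permutes {..<n}. of_int (sign p) *
     (\<Prod>j<n. f (permute_list p (shifted_weight n l) ! j - shifted_weight n m ! j)))"
  unfolding toeplitz_minor_shifted
  by (rule det_permutation_expansion[OF length_shifted_weight, of n "\<lambda>b j. f (b - shifted_weight n m ! j)"])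

text \<open>The linear map \<open>\<phi>\<close> that sends \<open>x ^ g\<close> to the product of the \<open>f (g ! j - b ! j)\<close> turns the
  alternant of \<open>l\<close> into the determinant of the \<open>f ((l + \<delta>) ! i - b ! j)\<close>. Applied to both sides of
  the identity between \<open>s\<^sub>l\<close> times the Vandermonde determinant and the alternant of \<open>l\<close>, it gives
  this lemma.\<close>

lemma schur_coeff_convolution:
  assumes "length b = n"
  shows "(\<Sum>e | schur_coeff n l e \<noteq> 0. schur_coeff n l e * Determinant.det (Matrix.mat n n
       (\<lambda>(i, j). f (shifted_weight n (replicate n 0) ! i - map2 (-) b e ! j)))) =
     (\<Sum>p | p permutes {..<n}. of_int (sign p) * (\<Prod>j<n. f (permute_list p (shifted_weight n l) ! j - b ! j)))"
proof -
  let ?S = "{e. schur_coeff n l e \<noteq> 0}" and ?P = "{p. p permutes {..<n}}"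
  let ?\<delta> = "shifted_weight n (replicate n 0)"
  let ?c = "\<lambda>(e, p). schur_coeff n l e * of_int (sign p)"
  let ?h = "\<lambda>(e, p). map2 (+) e (permute_list p ?\<delta>)"
  let ?\<phi> = "\<lambda>g. \<Prod>j<n. f (g ! j - b ! j)"
  have "(\<Sum>e\<in>?S. schur_coeff n l e * Determinant.det (Matrix.mat n n
       (\<lambda>(i, j). f (?\<delta> ! i - map2 (-) b e ! j)))) = (\<Sum>k\<in>?S \<times> ?P. ?c k * ?\<phi> (?h k))"
  proof -
    have "Determinant.det (Matrix.mat n n (\<lambda>(i, j). f (?\<delta> ! i - map2 (-) b e ! j))) =
        (\<Sum>p\<in>?P. of_int (sign p) * ?\<phi> (?h (e, p)))" if e: "e \<in> ?S" for e
    proof -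
      have len: "length e = n" using e length_schur_coeff by blast
      show ?thesis
        unfolding det_permutation_expansion[OF length_shifted_weight, of n "\<lambda>d j. f (d - map2 (-) b e ! j)"]
        using len assms
        by (intro sum.cong refl arg_cong2[of _ _ _ _ "(*)"] prod.cong) (auto simp: algebra_simps)
    qed
    then show ?thesis
      by (simp add: sum_distrib_left sum.cartesian_product case_prod_unfold mult.assoc)
  qed
  also have "\<dots> = (\<Sum>p\<in>?P. of_int (sign p) * ?\<phi> (permute_list p (shifted_weight n l)))"
  proof (rule laurent_functional_eq[where n = n])
    fix x assume x: "x \<in> nonzero_args n" "inj_on x {..<n}"
    have "(\<Sum>k\<in>?S \<times> ?P. ?c k * laurent_monomial n (?h k) x) =
        (\<Sum>(e, p)\<in>?S \<times> ?P. (schur_coeff n l e * laurent_monomial n e x) *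
           (of_int (sign p) * laurent_monomial n (permute_list p ?\<delta>) x))"
    proof (intro sum.cong refl, clarify)
      fix e p assume "schur_coeff n l e \<noteq> 0" "p permutes {..<n}"
      then have "laurent_monomial n (map2 (+) e (permute_list p ?\<delta>)) x =
          laurent_monomial n e x * laurent_monomial n (permute_list p ?\<delta>) x"
        using length_schur_coeff x(1) by (intro laurent_monomial_add) auto
      then show "schur_coeff n l e * of_int (sign p) * laurent_monomial n (map2 (+) e (permute_list p ?\<delta>)) x =
          schur_coeff n l e * laurent_monomial n e x *
          (of_int (sign p) * laurent_monomial n (permute_list p ?\<delta>) x)"
        by simp
    qed
    also have "\<dots> = schur n l x * alternant n (replicate n 0) x"
      unfolding schur_expansion[OF x(1)] alternant_expansion sum_product sum.cartesian_product ..
    also have "\<dots> = alternant n l x" by (rule schur_mult_alternant_zero[OF x])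
    also have "\<dots> = (\<Sum>p\<in>?P. of_int (sign p) * laurent_monomial n (permute_list p (shifted_weight n l)) x)"
      by (rule alternant_expansion)
    finally show "(\<Sum>k\<in>?S \<times> ?P. ?c k * laurent_monomial n (?h k) x) =
        (\<Sum>p\<in>?P. of_int (sign p) * laurent_monomial n (permute_list p (shifted_weight n l)) x)" .
  next
    show "finite (?S \<times> ?P)" "finite ?P"
      by (simp_all add: finite_schur_coeff finite_permutations)
    show "length (?h k) = n" if "k \<in> ?S \<times> ?P" for k
      using that length_schur_coeff[of n l] by (cases k) auto
  qed simp
  finally show ?thesis .
qed

text \<open>Insert the Racah-Speiser formula and move the sign of the permutation into the minor, which is
  alternating in its columns. The double sum over weights and permutations is then a sum over all
  integer vectors \<open>a\<close>, since the minor vanishes if \<open>a\<close> has a repeated entry. With \<open>a = t + \<delta> - e\<close> it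
  becomes a sum over the monomials of \<open>s\<^sub>l\<close>.\<close>

lemma toeplitz_minor_LR_sum:
  assumes t: "t \<in> weights n"
  shows "((\<lambda>m. toeplitz_minor n f (replicate n 0) m * LR_coeff n l m t) has_sum toeplitz_minor n f l t) (weights n)"
proof -
  let ?K = "schur_coeff n l" and ?b = "shifted_weight n t" and ?P = "{p. p permutes {..<n}}"
  let ?\<delta> = "shifted_weight n (replicate n 0)"
  define d where "d a = Determinant.det (Matrix.mat n n (\<lambda>(i, j). f (?\<delta> ! i - a ! j)))" for a
  have d_permute: "d (permute_list q a) = of_int (sign q) * d a" if "q permutes {..<n}" "length a = n" for q a
    unfolding d_def by (rule det_permute_argument[OF that(2,1)])
  \<comment> \<open>the vectors \<open>a = t + \<delta> - e\<close> for the monomials \<open>x ^ e\<close> of \<open>s\<^sub>l\<close>\<close>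
  define S where "S = map2 (-) ?b ` {e. ?K e \<noteq> 0}"
  have finS: "finite S" unfolding S_def by (intro finite_imageI finite_schur_coeff)
  have reflect: "map2 (-) ?b (map2 (-) ?b e) = e" if "length e = n" for e
    using that by (intro nth_equalityI) auto
  have S_iff: "a \<in> S \<longleftrightarrow> ?K (map2 (-) ?b a) \<noteq> 0" if "length a = n" for a
  proof
    assume "a \<in> S"
    then obtain e where "a = map2 (-) ?b e" "?K e \<noteq> 0" unfolding S_def by auto
    then show "?K (map2 (-) ?b a) \<noteq> 0"
      using reflect[of e] length_schur_coeff by metis
  next
    assume "?K (map2 (-) ?b a) \<noteq> 0"
    then show "a \<in> S" unfolding S_def
      by (intro image_eqI[of _ _ "map2 (-) ?b a"]) (use reflect[OF that] in simp_all)
  qed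
  have lenS: "length a = n" if "a \<in> S" for a
    using that length_schur_coeff[of n l] by (auto simp: S_def)
  define \<Phi> where "\<Phi> a = (if length a = n then ?K (map2 (-) ?b a) * d a else 0)" for a
  \<comment> \<open>finitely many weights, outside of which all Littlewood-Richardson coefficients in question vanish\<close>
  define W where "W = {m \<in> weights n. \<exists>p. p permutes {..<n} \<and> permute_list p (shifted_weight n m) \<in> S}"
  have finW: "finite W" unfolding W_def by (rule finite_weights_meeting[OF finS])
  have LR: "LR_coeff n l m t = (\<Sum>p\<in>?P. of_int (sign p) * ?K (map2 (-) ?b (permute_list p (shifted_weight n m))))" for m
    using t by (simp add: LR_coeff_eq racah_speiser_coeff_def schur_alternant_coeff_def)
  have "(\<Sum>m\<in>W. toeplitz_minor n f (replicate n 0) m * LR_coeff n l m t) =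
      (\<Sum>m\<in>W. \<Sum>p\<in>?P. \<Phi> (permute_list p (shifted_weight n m)))"
    by (simp add: LR toeplitz_minor_shifted \<Phi>_def d_permute sum_distrib_left mult_ac flip: d_def)
  also have "\<dots> = (\<Sum>a\<in>S. \<Phi> a)"
  proof (rule sum_distinct_lists[OF finS _ _ finW])
    show "{a. \<Phi> a \<noteq> 0} \<subseteq> S" using S_iff by (auto simp: \<Phi>_def split: if_splits)
    show "length a = n \<and> distinct a" if "\<Phi> a \<noteq> 0" for a
      using that alternating_not_distinct[of a d] d_permute by (auto simp: \<Phi>_def split: if_splits)
    show "W \<subseteq> weights n" by (auto simp: W_def)
    show "m \<in> W" if "m \<in> weights n" "p permutes {..<n}" "\<Phi> (permute_list p (shifted_weight n m)) \<noteq> 0" for m p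
      using that S_iff by (auto simp: \<Phi>_def W_def split: if_splits)
  qed
  also have "\<dots> = (\<Sum>e | ?K e \<noteq> 0. ?K e * d (map2 (-) ?b e))"
  proof (rule sum.reindex_bij_witness[where i = "map2 (-) ?b" and j = "map2 (-) ?b"])
    fix a assume a: "a \<in> S"
    then show "map2 (-) ?b (map2 (-) ?b a) = a" by (intro reflect lenS)
    then show "?K (map2 (-) ?b a) * d (map2 (-) ?b (map2 (-) ?b a)) = \<Phi> a"
      using lenS[OF a] by (simp add: \<Phi>_def)
    show "map2 (-) ?b a \<in> {e. ?K e \<noteq> 0}"
      using a S_iff[OF lenS[OF a]] by simp
  next
    fix e assume e: "e \<in> {e. ?K e \<noteq> 0}"
    then show "map2 (-) ?b (map2 (-) ?b e) = e"
      using length_schur_coeff by (intro reflect) blast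
    show "map2 (-) ?b e \<in> S" using e by (simp add: S_def)
  qed
  also have "\<dots> = toeplitz_minor n f l t"
    unfolding d_def toeplitz_minor_expansion by (rule schur_coeff_convolution) simp
  finally have "(\<Sum>m\<in>W. toeplitz_minor n f (replicate n 0) m * LR_coeff n l m t) = toeplitz_minor n f l t" .
  moreover have "LR_coeff n l m t = 0" if "m \<in> weights n - W" for m
    unfolding LR using that S_iff by (intro sum.neutral) (auto simp: W_def)
  ultimately show ?thesis
    using finW by (intro has_sum_finite_neutralI[of W]) (auto simp: W_def)
qed

theorem theorem3p1:
  fixes n :: nat
    and \<theta> :: "nat \<Rightarrow> complex"
    and F :: "complex \<Rightarrow> complex"
    and r :: real and R :: ereal
    and \<gamma> :: "real \<Rightarrow> complex"
    and l t :: "int list"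
  assumes "n \<ge> 1"
    and "\<And>j. j < n \<Longrightarrow> \<theta> j \<noteq> 0"
    and "F \<in> elementary_functions"
    and "0 \<le> r"
    and "F analytic_on annulus r R"
    and "\<And>j. j < n \<Longrightarrow> inverse (\<theta> j) \<in> annulus r R"
    and "\<And>j. j < n \<Longrightarrow> F (inverse (\<theta> j)) \<noteq> 0"
    and "simple_positive_loop (annulus r R) \<gamma>"
    and "\<And>v. v \<in> weights n \<Longrightarrow> schur n v \<theta> \<noteq> 0"
    and "l \<in> weights n" and "t \<in> weights n"
  shows "((\<lambda>m. P_weight n \<theta> F \<gamma> m * LR_coeff n l m t *
             (schur n t \<theta> / (schur n l \<theta> * schur n m \<theta>)))
          has_sum T_matrix n \<theta> F \<gamma> l t) (weights n)"
proof -
  define C where "C = schur n t \<theta> / schur n l \<theta> / (\<Prod>j<n. F (inverse (\<theta> j)))"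
  let ?D = "toeplitz_minor n (loop_coeff \<gamma> F)"
  have T: "T_matrix n \<theta> F \<gamma> l t = C * ?D l t"
    by (simp add: T_matrix_def C_def toeplitz_minor_def)
  have "schur n (replicate n 0) \<theta> = 1"
    using assms(2) by (intro schur_zero) (simp add: nonzero_args_def)
  then have P: "P_weight n \<theta> F \<gamma> m * LR_coeff n l m t * (schur n t \<theta> / (schur n l \<theta> * schur n m \<theta>)) =
      C * (?D (replicate n 0) m * LR_coeff n l m t)" if "m \<in> weights n" for m
  proof -
    have "P_weight n \<theta> F \<gamma> m = schur n m \<theta> * (?D (replicate n 0) m / (\<Prod>j<n. F (inverse (\<theta> j))))"
      using \<open>schur n (replicate n 0) \<theta> = 1\<close>
      by (simp add: P_weight_def T_matrix_def toeplitz_minor_def)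
    moreover have "(\<Prod>j<n. F (inverse (\<theta> j))) \<noteq> 0" using assms(7) by simp
    ultimately show ?thesis
      using assms(9)[OF that] assms(9)[OF assms(10)] by (simp add: C_def field_simps)
  qed
  have "((\<lambda>m. C * (?D (replicate n 0) m * LR_coeff n l m t)) has_sum C * ?D l t) (weights n)"
    by (intro has_sum_cmult_right toeplitz_minor_LR_sum assms(11))
  then show ?thesis
    unfolding T using P by (simp cong: has_sum_cong)
qed

end
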